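(* Let $p$ be a prime, $\Gamma=\mathrm{P}\Gamma_0(p)$, $Y=\Gamma\backslash H$, and let $\widehat C\subseteq SY$ be the set $$\widehat C=\bigcup_{k=0}^{p}\ \bigcup_{y>0}\Big(\pi\big(S_{\frac kp+iy}H\big)\setminus\Big\{\pi\big(y\tfrac{\partial}{\partial y}|_{\frac kp+iy}\big),\ \pi\big(-y\tfrac{\partial}{\partial y}|_{\frac kp+iy}\big)\Big\}\Big).$$ Then $\widehat C$ is a cross section for the geodesic flow $\widehat\Phi$ on $Y$ with respect to any measure $\mu$ on the space of geodesics of $Y$ that is induced by a Borel probability measure on $SY$ invariant under $\{\widehat\Phi_t\}_{t\in\mathbb{R}}$.
   Context: $H=\{z\in\mathbb{C}\mid \operatorname{Im}z>0\}$ carries the metric $ds^2=y^{-2}(dx^2+dy^2)$; $\mathrm{PSL}(2,\mathbb{R})$ acts on $H$ by Möbius transformations. $SH$ is the unit tangent bundle of $H$ and $S_zH$ its fiber at $z$. Geodesics are oriented and parametrized by arc length; for $v\in SH$, $\gamma_v$ is the unit speed geodesic with $\gamma_v'(0)=v$, and the geodesic flow on $H$ is $\Phi_t(v)=\gamma_v'(t)$. $\mathrm{P}\Gamma_0(p)=\{\begin{pmatrix}a&b\\c&d\end{pmatrix}\in \mathrm{PSL}(2,\mathbb{Z})\mid c\equiv 0 \bmod p\}$. $\Gamma$ acts on $SH$ by differentials; $SY$ denotes $\Gamma\backslash SH$ and $\pi: SH\to SY$ the projection. The geodesics on $Y$ are the $\Gamma$-equivalence classes of geodesics on $H$; if $\hat\gamma$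 is represented by $\gamma$ then $\hat\gamma'(t)=\pi(\gamma'(t))$. The geodesic flow on $Y$ is $\widehat\Phi_t(\pi(v))=\pi(\Phi_t(v))$. A geodesic $\hat\gamma$ on $Y$ intersects $\widehat C$ infinitely often in future (resp. in past) if there is a sequence $(t_n)$ with $t_n\to\infty$ (resp. $t_n\to-\infty$) and $\hat\gamma'(t_n)\in\widehat C$ for all $n$. For a measure $\mu$ on the space of geodesics on $Y$, a subset $\widehat C\subseteq SY$ is a cross section with respect to $\mu$ if: (C1) $\mu$-almost every geodesic on $Y$ intersects $\widehat C$ infinitely often in past and future; (C2) each intersection is discrete in time: for every geodesic $\hat\gamma$ on $Y$, if $\hat\gamma'(t)\in\widehat C$, then there is $\varepsilon>0$ such that $\hat\gamma'((t-\varepsilon,t+\varepsilon))\cap\widehat C=\{\hat\gamma'(t)\}$. When $\mu$ is induced by a $\widehat\Phi$-invariant Borel probability measure $\nu$ on $SY$, a property holds for $\mu$-almost every geodesic if and only if the set of all unit tangent vectors in $SY$ to geodesics failing the property is a $\nu$-null set. *)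

theory Defs
  imports "HOL-Probability.Probability" "HOL-Computational_Algebra.Primes"
begin

text \<open>
  The tangent bundle of the upper half plane \<open>H\<close> is trivialised: a tangent vector is a pair
  \<open>(z, w)\<close> of base point and direction, the coordinate fields \<open>\<partial>/\<partial>x\<close> and \<open>\<partial>/\<partial>y\<close> being
  the directions \<open>1\<close> and \<open>\<i>\<close>.
\<close>

definition upper_half_plane :: "complex set" where
  "upper_half_plane = {z. Im z > 0}"

definition hyp_metric :: "complex \<Rightarrow> complex \<Rightarrow> complex \<Rightarrow> real" where
  "hyp_metric z u v = (u \<bullet> v) / (Im z)\<^sup>2"

definition unit_tangent_at :: "complex \<Rightarrow> (complex \<times> complex) set" where
  "unit_tangent_at z = {(z, w) | w. hyp_metric z w w = 1}"

definition unit_tangent_bundle :: "(complex \<times> complex) set" where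
  "unit_tangent_bundle = (\<Union>z\<in>upper_half_plane. unit_tangent_at z)"

text \<open>
  Derivative of the metric coefficient \<open>g(v, w)\<close>, for constant directions \<open>v\<close> and \<open>w\<close>, in the
  direction \<open>u\<close>.
\<close>

definition metric_deriv :: "complex \<Rightarrow> complex \<Rightarrow> complex \<Rightarrow> complex \<Rightarrow> real" where
  "metric_deriv z u v w = deriv (\<lambda>s::real. hyp_metric (z + s *\<^sub>R u) v w) 0"

text \<open>
  Koszul formula: in the given coordinates the Levi-Civita connection satisfies
  \<open>g(\<nabla>\<^sub>u v, w) = g(D\<^sub>u v, w) + (D\<^sub>u g(v, w) + D\<^sub>v g(u, w) - D\<^sub>w g(u, v)) / 2\<close>,
  where the derivatives of \<open>g\<close> are those of its coefficients. A geodesic is a curve with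
  vanishing covariant acceleration.
\<close>

definition christoffel :: "complex \<Rightarrow> complex \<Rightarrow> complex \<Rightarrow> complex \<Rightarrow> real" where
  "christoffel z u v w = (metric_deriv z u v w + metric_deriv z v u w - metric_deriv z w u v) / 2"

definition geodesic :: "(real \<Rightarrow> complex) \<Rightarrow> bool" where
  "geodesic \<gamma> \<longleftrightarrow> (\<exists>\<gamma>' \<gamma>''. \<forall>t.
     \<gamma> t \<in> upper_half_plane \<and>
     (\<gamma> has_vector_derivative \<gamma>' t) (at t) \<and>
     (\<gamma>' has_vector_derivative \<gamma>'' t) (at t) \<and>
     hyp_metric (\<gamma> t) (\<gamma>' t) (\<gamma>' t) = 1 \<and>
     (\<forall>w. hyp_metric (\<gamma> t) (\<gamma>'' t) w + christoffel (\<gamma> t) (\<gamma>' t) (\<gamma>' t) w = 0))"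

definition tangent :: "(real \<Rightarrow> complex) \<Rightarrow> real \<Rightarrow> complex \<times> complex" where
  "tangent \<gamma> t = (\<gamma> t, vector_derivative \<gamma> (at t))"

definition geodesic_of :: "complex \<times> complex \<Rightarrow> real \<Rightarrow> complex" where
  "geodesic_of v = (THE \<gamma>. geodesic \<gamma> \<and> tangent \<gamma> 0 = v)"

definition geodesic_flow :: "real \<Rightarrow> complex \<times> complex \<Rightarrow> complex \<times> complex" where
  "geodesic_flow t v = tangent (geodesic_of v) t"

text \<open>
  Elements of \<open>P\<Gamma>\<^sub>0(p)\<close> are represented by their matrices in \<open>SL(2,\<int>)\<close>. The two representatives
  \<open>A\<close> and \<open>-A\<close> of an element act identically, so the orbits are the same.
\<close>

definition Gamma0 :: "nat \<Rightarrow> (int ^ 2 ^ 2) set" where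
  "Gamma0 p = {A. det A = 1 \<and> int p dvd A $ 2 $ 1}"

definition moebius :: "int ^ 2 ^ 2 \<Rightarrow> complex \<Rightarrow> complex" where
  "moebius A z = (of_int (A $ 1 $ 1) * z + of_int (A $ 1 $ 2)) /
                 (of_int (A $ 2 $ 1) * z + of_int (A $ 2 $ 2))"

definition moebius_tangent :: "int ^ 2 ^ 2 \<Rightarrow> complex \<times> complex \<Rightarrow> complex \<times> complex" where
  "moebius_tangent A = (\<lambda>(z, w). (moebius A z, deriv (moebius A) z * w))"

text \<open>Points of \<open>SY = \<Gamma>\SH\<close> are the \<open>\<Gamma>\<close>-orbits in \<open>SH\<close>.\<close>

definition proj :: "nat \<Rightarrow> complex \<times> complex \<Rightarrow> (complex \<times> complex) set" where
  "proj p v = (\<lambda>A. moebius_tangent A v) ` Gamma0 p"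

definition SY :: "nat \<Rightarrow> (complex \<times> complex) set set" where
  "SY p = proj p ` unit_tangent_bundle"

text \<open>Open sets of the quotient topology on \<open>SY\<close>, and the \<open>\<sigma>\<close>-algebra they generate.\<close>

definition SY_opens :: "nat \<Rightarrow> (complex \<times> complex) set set set" where
  "SY_opens p = {U. U \<subseteq> SY p \<and>
     openin (top_of_set unit_tangent_bundle) {v \<in> unit_tangent_bundle. proj p v \<in> U}}"

definition SY_borel :: "nat \<Rightarrow> (complex \<times> complex) set measure" where
  "SY_borel p = sigma (SY p) (SY_opens p)"

definition flowY :: "nat \<Rightarrow> real \<Rightarrow> (complex \<times> complex) set \<Rightarrow> (complex \<times> complex) set" where
  "flowY p t q = (THE u. \<exists>v\<in>unit_tangent_bundle. q = proj p v \<and> u = proj p (geodesic_flow t v))"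

definition invariant_borel_prob :: "nat \<Rightarrow> (complex \<times> complex) set measure \<Rightarrow> bool" where
  "invariant_borel_prob p \<nu> \<longleftrightarrow>
     prob_space \<nu> \<and> space \<nu> = SY p \<and> sets \<nu> = sets (SY_borel p) \<and>
     (\<forall>t. \<forall>A\<in>sets \<nu>. emeasure \<nu> (flowY p t -` A \<inter> space \<nu>) = emeasure \<nu> A)"

text \<open>Geodesics on \<open>Y\<close>: \<open>\<Gamma>\<close>-equivalence classes of (parametrized) geodesics on \<open>H\<close>.\<close>

definition geodesic_class :: "nat \<Rightarrow> (real \<Rightarrow> complex) \<Rightarrow> (real \<Rightarrow> complex) set" where
  "geodesic_class p \<gamma> = (\<lambda>A. moebius A \<circ> \<gamma>) ` Gamma0 p"

definition geodesicsY :: "nat \<Rightarrow> (real \<Rightarrow> complex) set set" where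
  "geodesicsY p = geodesic_class p ` {\<gamma>. geodesic \<gamma>}"

definition tangentY :: "nat \<Rightarrow> (real \<Rightarrow> complex) set \<Rightarrow> real \<Rightarrow> (complex \<times> complex) set" where
  "tangentY p G t = (THE u. \<exists>\<gamma>\<in>G. u = proj p (tangent \<gamma> t))"

definition time_shift :: "real \<Rightarrow> (real \<Rightarrow> complex) set \<Rightarrow> (real \<Rightarrow> complex) set" where
  "time_shift s G = (\<lambda>\<gamma> t. \<gamma> (t + s)) ` G"

text \<open>
  A measure on the space of geodesics is induced by \<open>\<nu>\<close> if a property of geodesics holds almost
  everywhere iff the set of all unit tangent vectors to geodesics failing it is null for \<open>\<nu>\<close>.
  This concerns properties of oriented geodesics, i.e. those independent of the choice of the
  time origin. In this way both the push-forward of \<open>\<nu>\<close> to parametrized geodesics and its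
  restriction to shift-invariant events qualify. Null sets are those of the completion, since
  the failing set need not be Borel.
\<close>

definition induced_by ::
  "nat \<Rightarrow> (complex \<times> complex) set measure \<Rightarrow> (real \<Rightarrow> complex) set measure \<Rightarrow> bool" where
  "induced_by p \<nu> \<mu> \<longleftrightarrow>
     space \<mu> = geodesicsY p \<and>
     (\<forall>P. (\<forall>G\<in>geodesicsY p. \<forall>s. P (time_shift s G) \<longleftrightarrow> P G) \<longrightarrow>
        ((AE G in \<mu>. P G) \<longleftrightarrow>
         {tangentY p G t | G t. G \<in> geodesicsY p \<and> \<not> P G} \<in> null_sets (completion \<nu>)))"

definition infinitely_often_future ::
  "nat \<Rightarrow> (complex \<times> complex) set set \<Rightarrow> (real \<Rightarrow> complex) set \<Rightarrow> bool" where
  "infinitely_often_future p C G \<longleftrightarrow>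
     (\<exists>t :: nat \<Rightarrow> real. filterlim t at_top sequentially \<and> (\<forall>n. tangentY p G (t n) \<in> C))"

definition infinitely_often_past ::
  "nat \<Rightarrow> (complex \<times> complex) set set \<Rightarrow> (real \<Rightarrow> complex) set \<Rightarrow> bool" where
  "infinitely_often_past p C G \<longleftrightarrow>
     (\<exists>t :: nat \<Rightarrow> real. filterlim t at_bot sequentially \<and> (\<forall>n. tangentY p G (t n) \<in> C))"

definition cross_section ::
  "nat \<Rightarrow> (real \<Rightarrow> complex) set measure \<Rightarrow> (complex \<times> complex) set set \<Rightarrow> bool" where
  "cross_section p \<mu> C \<longleftrightarrow>
     C \<subseteq> SY p \<and>
     (AE G in \<mu>. infinitely_often_past p C G \<and> infinitely_often_future p C G) \<and>
     (\<forall>G\<in>geodesicsY p. \<forall>t. tangentY p G t \<in> C \<longrightarrow>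
        (\<exists>\<epsilon>>0. tangentY p G ` {t - \<epsilon> <..< t + \<epsilon>} \<inter> C = {tangentY p G t}))"

definition C_hat :: "nat \<Rightarrow> (complex \<times> complex) set set" where
  "C_hat p = (\<Union>k\<in>{0..p}. \<Union>y\<in>{0::real<..}.
     let z = Complex (real k / real p) y in
       proj p ` unit_tangent_at z -
         {proj p (z, y *\<^sub>R \<i>), proj p (z, - (y *\<^sub>R \<i>))})"

end

theory Submission imports Defs begin

text \<open>
  Geodesics of the upper half plane satisfy \<open>\<gamma>'' = -\<i> \<gamma>'\<^sup>2 / y\<close>. Along a unit speed solution the
  functions \<open>1/y\<close> and \<open>x/y\<close> solve the linear equation \<open>F'' = F\<close>, so they are combinations of
  \<open>exp t\<close> and \<open>exp (-t)\<close>. These explicit coordinates give existence and uniqueness of geodesics, their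
  endpoints at infinity, and the number of times they meet another geodesic.

  The vertical lines over \<open>k/p\<close>, once multiplied by \<open>p\<close>, become the vertical edges of the
  Farey tessellation, and the group \<open>\<Gamma>\<^sub>0(p)\<close> becomes a subgroup of \<open>SL(2,\<int>)\<close> of index \<open>p + 1\<close>. Every
  edge of the tessellation is a translate of a vertical one, because at least one of its two
  endpoints can be moved to infinity by this subgroup (\<open>farey_edge_equivalent_to_vertical\<close>). A geodesic with irrational endpoint \<open>\<xi>\<close> has to enter
  arbitrarily small Farey semicircles around \<open>p\<xi>\<close>, so it meets translates of the vertical
  lines at arbitrarily late times (\<open>noncuspidal_crosses\<close>). Such a crossing is always in the cross
  section, because a geodesic that is somewhere equivalent to a vertical vector over \<open>k/p\<close> runs into a
  cusp at both ends.

  The remaining geodesics, those that end in a cusp, leave every compact part of the quotient. The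
  part of the quotient lying high in some cusp shrinks to the empty set, so its measure tends to \<open>0\<close>,
  while an invariant probability measure assigns the same measure to all its preimages under the flow.
  Hence the set of vectors that eventually stay above every height is null
  (\<open>null_eventually_in_vanishing\<close>, \<open>cuspidal_null\<close>).

  For discreteness, a translate of a vertical line is the zero set of an integral form
  \<open>P |z|\<^sup>2 + Q x + R\<close> of discriminant \<open>p\<^sup>2\<close>. Only finitely many such forms have a zero in a given
  compact set, and each of them has only finitely many zeros along a geodesic unless it vanishes
  identically on it. In the latter case the geodesic is tangent to the translate, and tangential
  vectors have been removed from the cross section. So a geodesic meets the cross section finitely
  often in bounded time (\<open>finite_C_hat_times\<close>).
\<close>

section \<open>Fractional linear action\<close>

definition automorphy :: "int ^ 2 ^ 2 \<Rightarrow> complex \<Rightarrow> complex" where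
  "automorphy A z = of_int (A $ 2 $ 1) * z + of_int (A $ 2 $ 2)"

lemma int_lin_nonzero:
  fixes c d :: int
  assumes "Im z > 0" "(c, d) \<noteq> (0, 0)"
  shows "of_int c * z + of_int d \<noteq> 0"
proof
  assume h: "of_int c * z + of_int d = 0"
  have "of_int c * Im z = 0" using arg_cong[OF h, of Im] by simp
  then have "c = 0" using assms(1) by simp
  then show False using h assms(2) by simp
qed

lemma automorphy_nonzero:
  assumes "det A = 1" "Im z > 0"
  shows "automorphy A z \<noteq> 0"
proof -
  have "(A $ 2 $ 1, A $ 2 $ 2) \<noteq> (0, 0)"
    using assms(1) by (auto simp: det_2)
  then show ?thesis
    unfolding automorphy_def by (rule int_lin_nonzero[OF assms(2)])
qed

lemma moebius_automorphy: "moebius A z = (of_int (A $ 1 $ 1) * z + of_int (A $ 1 $ 2)) / automorphy A z"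
  by (simp add: moebius_def automorphy_def)

lemma det_of_int:
  fixes A :: "int ^ 2 ^ 2"
  assumes "det A = 1"
  shows "(of_int (A $ 1 $ 1) * of_int (A $ 2 $ 2) :: 'a::comm_ring_1)
    = 1 + of_int (A $ 1 $ 2) * of_int (A $ 2 $ 1)"
proof -
  have "A $ 1 $ 1 * A $ 2 $ 2 = 1 + A $ 1 $ 2 * A $ 2 $ 1"
    using assms by (simp add: det_2)
  from arg_cong[OF this, of "of_int :: int \<Rightarrow> 'a"] show ?thesis by simp
qed

lemma moebius_has_derivative:
  assumes "det A = 1" "Im z > 0"
  shows "(moebius A has_field_derivative 1 / (automorphy A z)\<^sup>2) (at z)"
proof -
  let ?a = "of_int (A $ 1 $ 1) :: complex" and ?b = "of_int (A $ 1 $ 2) :: complex"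
  let ?c = "of_int (A $ 2 $ 1) :: complex" and ?d = "of_int (A $ 2 $ 2) :: complex"
  have nz: "?c * z + ?d \<noteq> 0"
    using automorphy_nonzero[OF assms] by (simp add: automorphy_def)
  have "((\<lambda>z. (?a * z + ?b) / (?c * z + ?d)) has_field_derivative
      (?a * (?c * z + ?d) - (?a * z + ?b) * ?c) / ((?c * z + ?d) * (?c * z + ?d))) (at z)"
    by (rule derivative_eq_intros refl nz | simp)+
  moreover have "?a * (?c * z + ?d) - (?a * z + ?b) * ?c = ?a * ?d - ?b * ?c"
    by (simp add: algebra_simps)
  then have "?a * (?c * z + ?d) - (?a * z + ?b) * ?c = 1"
    by (simp add: det_of_int[OF assms(1)])
  ultimately show ?thesis
    unfolding moebius_def[abs_def] automorphy_def by (simp add: power2_eq_square)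
qed

lemma deriv_moebius:
  assumes "det A = 1" "Im z > 0"
  shows "deriv (moebius A) z = 1 / (automorphy A z)\<^sup>2"
  using moebius_has_derivative[OF assms] by (rule DERIV_imp_deriv)

lemma Im_divide_cnj: "Im (w / u) = Im (w * cnj u) / (cmod u)\<^sup>2"
  unfolding Im_divide cmod_power2 by simp

lemma Im_linear_mult_cnj:
  fixes a b c d :: int
  shows "Im ((of_int a * z + of_int b) * cnj (of_int c * z + of_int d)) = (a * d - b * c) * Im z"
  by (simp add: algebra_simps)

lemma Im_moebius:
  assumes "det A = 1" "Im z > 0"
  shows "Im (moebius A z) = Im z / (cmod (automorphy A z))\<^sup>2"
proof -
  have "A $ 1 $ 1 * A $ 2 $ 2 - A $ 1 $ 2 * A $ 2 $ 1 = 1"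
    using assms by (simp add: det_2)
  then show ?thesis
    unfolding moebius_def Im_divide_cnj Im_linear_mult_cnj automorphy_def by simp
qed

lemma Im_moebius_pos:
  assumes "det A = 1" "Im z > 0"
  shows "Im (moebius A z) > 0"
  using Im_moebius[OF assms] automorphy_nonzero[OF assms] assms(2) by simp

lemma automorphy_mult:
  assumes "det B = 1" "Im z > 0"
  shows "automorphy (A ** B) z = automorphy A (moebius B z) * automorphy B z"
proof -
  have "automorphy B z \<noteq> 0" by (rule automorphy_nonzero[OF assms])
  then show ?thesis
    by (simp add: automorphy_def[of A] moebius_automorphy field_simps)
       (simp add: automorphy_def matrix_matrix_mult_def sum_2 algebra_simps)
qed

lemma moebius_mult:
  assumes "det A = 1" "det B = 1" "Im z > 0"
  shows "moebius (A ** B) z = moebius A (moebius B z)"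
proof -
  have nz: "automorphy B z \<noteq> 0" by (rule automorphy_nonzero[OF assms(2,3)])
  have "of_int ((A ** B) $ 1 $ 1) * z + of_int ((A ** B) $ 1 $ 2) =
    (of_int (A $ 1 $ 1) * moebius B z + of_int (A $ 1 $ 2)) * automorphy B z"
    using nz by (simp add: moebius_automorphy[of B] field_simps)
       (simp add: automorphy_def matrix_matrix_mult_def sum_2 algebra_simps)
  then show ?thesis
    using nz by (simp add: moebius_automorphy[of "A ** B"] moebius_automorphy[of A] automorphy_mult[OF assms(2,3)])
qed

lemma moebius_one [simp]: "moebius (mat 1) z = z"
  by (simp add: moebius_def mat_def)

lemma automorphy_one [simp]: "automorphy (mat 1) z = 1"
  by (simp add: automorphy_def mat_def)

lemma Gamma0_det: "A \<in> Gamma0 p \<Longrightarrow> det A = 1"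
  by (simp add: Gamma0_def)

lemma Gamma0_one: "mat 1 \<in> Gamma0 p"
  by (simp add: Gamma0_def) (simp add: mat_def)

lemma Gamma0_mult: "A \<in> Gamma0 p \<Longrightarrow> B \<in> Gamma0 p \<Longrightarrow> A ** B \<in> Gamma0 p"
  by (auto simp: Gamma0_def det_mul) (auto simp: matrix_matrix_mult_def sum_2)

definition mat2 :: "int \<Rightarrow> int \<Rightarrow> int \<Rightarrow> int \<Rightarrow> int ^ 2 ^ 2" where
  "mat2 a b c d = vector [vector [a, b], vector [c, d]]"

lemma mat2_nth [simp]:
  "mat2 a b c d $ 1 $ 1 = a" "mat2 a b c d $ 1 $ 2 = b"
  "mat2 a b c d $ 2 $ 1 = c" "mat2 a b c d $ 2 $ 2 = d"
  by (simp_all add: mat2_def)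

lemma det_mat2 [simp]: "det (mat2 a b c d) = a * d - b * c"
  by (simp add: det_2)

lemma Gamma0_inverse:
  assumes "A \<in> Gamma0 p"
  obtains B where "B \<in> Gamma0 p" "B ** A = mat 1"
proof
  let ?B = "mat2 (A $ 2 $ 2) (- A $ 1 $ 2) (- A $ 2 $ 1) (A $ 1 $ 1)"
  have d: "A $ 1 $ 1 * A $ 2 $ 2 - A $ 1 $ 2 * A $ 2 $ 1 = 1"
    using assms by (simp add: Gamma0_def det_2)
  show "?B \<in> Gamma0 p"
    using assms d by (simp add: Gamma0_def algebra_simps)
  show "?B ** A = mat 1"
    using d by (simp add: vec_eq_iff forall_2 matrix_matrix_mult_def sum_2 mat_def algebra_simps)
qed

lemma unit_tangent_bundle_iff:
  "(z, w) \<in> unit_tangent_bundle \<longleftrightarrow> Im z > 0 \<and> cmod w = Im z"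
proof -
  have "w \<bullet> w = (Im z)\<^sup>2 \<longleftrightarrow> cmod w = Im z" if "Im z > 0"
    using that by (simp add: dot_square_norm power2_eq_iff_nonneg)
  then show ?thesis
    by (auto simp: unit_tangent_bundle_def unit_tangent_at_def upper_half_plane_def hyp_metric_def)
qed

lemma moebius_tangent_eq:
  assumes "det A = 1" "Im z > 0"
  shows "moebius_tangent A (z, w) = (moebius A z, w / (automorphy A z)\<^sup>2)"
  by (simp add: moebius_tangent_def deriv_moebius[OF assms])

lemma moebius_tangent_bundle:
  assumes "det A = 1" "v \<in> unit_tangent_bundle"
  shows "moebius_tangent A v \<in> unit_tangent_bundle"
proof -
  obtain z w where v: "v = (z, w)" by (cases v)
  have z: "Im z > 0" "cmod w = Im z" using assms(2) v by (auto simp: unit_tangent_bundle_iff)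
  show ?thesis
    using z Im_moebius_pos[OF assms(1) z(1)] Im_moebius[OF assms(1) z(1)]
    by (simp add: v moebius_tangent_eq[OF assms(1) z(1)] unit_tangent_bundle_iff norm_divide norm_power)
qed

lemma moebius_tangent_mult:
  assumes "det A = 1" "det B = 1" "v \<in> unit_tangent_bundle"
  shows "moebius_tangent (A ** B) v = moebius_tangent A (moebius_tangent B v)"
proof -
  obtain z w where v: "v = (z, w)" by (cases v)
  have z: "Im z > 0" using assms(3) v by (auto simp: unit_tangent_bundle_iff)
  have d: "det (A ** B) = 1" using assms by (simp add: det_mul)
  show ?thesis
    by (simp add: v moebius_tangent_eq[OF d z] moebius_tangent_eq[OF assms(2) z]
      moebius_tangent_eq[OF assms(1) Im_moebius_pos[OF assms(2) z]]
      moebius_mult[OF assms(1,2) z] automorphy_mult[OF assms(2) z] power_mult_distrib mult.commute)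
qed

lemma moebius_tangent_one:
  assumes "v \<in> unit_tangent_bundle"
  shows "moebius_tangent (mat 1) v = v"
proof -
  obtain z w where v: "v = (z, w)" by (cases v)
  then show ?thesis
    using moebius_tangent_eq[of "mat 1" z w] assms by (simp add: unit_tangent_bundle_iff)
qed

lemma proj_self: "v \<in> unit_tangent_bundle \<Longrightarrow> v \<in> proj p v"
  unfolding proj_def using moebius_tangent_one[of v] Gamma0_one[of p] by force

lemma proj_moebius_tangent:
  assumes "A \<in> Gamma0 p" "v \<in> unit_tangent_bundle"
  shows "proj p (moebius_tangent A v) = proj p v"
proof -
  have sub: "proj p (moebius_tangent B u) \<subseteq> proj p u" if "B \<in> Gamma0 p" "u \<in> unit_tangent_bundle" for B u
  proof
    fix x assume "x \<in> proj p (moebius_tangent B u)"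
    then obtain A where A: "A \<in> Gamma0 p" "x = moebius_tangent A (moebius_tangent B u)"
      by (auto simp: proj_def)
    then have "x = moebius_tangent (A ** B) u"
      using moebius_tangent_mult[OF Gamma0_det[OF A(1)] Gamma0_det[OF that(1)] that(2)] by simp
    then show "x \<in> proj p u"
      unfolding proj_def by (rule image_eqI) (rule Gamma0_mult[OF A(1) that(1)])
  qed
  obtain B where B: "B \<in> Gamma0 p" "B ** A = mat 1" using Gamma0_inverse[OF assms(1)] .
  have "moebius_tangent B (moebius_tangent A v) = v"
    using moebius_tangent_mult[OF Gamma0_det[OF B(1)] Gamma0_det[OF assms(1)] assms(2)] B(2)
      moebius_tangent_one[OF assms(2)] by simp
  then show ?thesis
    using sub[OF assms] sub[OF B(1) moebius_tangent_bundle[OF Gamma0_det[OF assms(1)] assms(2)]] by auto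
qed

lemma proj_eq_iff:
  assumes "u \<in> unit_tangent_bundle" "v \<in> unit_tangent_bundle"
  shows "proj p u = proj p v \<longleftrightarrow> (\<exists>A\<in>Gamma0 p. u = moebius_tangent A v)"
proof
  assume "proj p u = proj p v"
  then have "u \<in> proj p v" using proj_self[OF assms(1), of p] by simp
  then show "\<exists>A\<in>Gamma0 p. u = moebius_tangent A v" by (auto simp: proj_def)
next
  assume "\<exists>A\<in>Gamma0 p. u = moebius_tangent A v"
  then show "proj p u = proj p v" using proj_moebius_tangent[OF _ assms(2)] by blast
qed

section \<open>Geodesics of the upper half plane\<close>

lemma metric_deriv_eq:
  assumes "Im z > 0"
  shows "metric_deriv z u v w = - 2 * (v \<bullet> w) * Im u / (Im z) ^ 3"
proof -
  have "((\<lambda>s::real. (v \<bullet> w) / (Im z + s * Im u)\<^sup>2) has_real_derivative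
     - (v \<bullet> w) * (2 * Im z * Im u) / ((Im z)\<^sup>2 * (Im z)\<^sup>2)) (at 0)"
    using assms by (auto intro!: derivative_eq_intros)
  then have "((\<lambda>s::real. hyp_metric (z + s *\<^sub>R u) v w) has_real_derivative
     - (v \<bullet> w) * (2 * Im z * Im u) / ((Im z)\<^sup>2 * (Im z)\<^sup>2)) (at 0)"
    by (simp add: hyp_metric_def)
  then have "metric_deriv z u v w = - (v \<bullet> w) * (2 * Im z * Im u) / ((Im z)\<^sup>2 * (Im z)\<^sup>2)"
    unfolding metric_deriv_def by (rule DERIV_imp_deriv)
  also have "\<dots> = - 2 * (v \<bullet> w) * Im u / (Im z) ^ 3"
    using assms by (simp add: field_simps power2_eq_square power3_eq_cube)
  finally show ?thesis .
qed

text \<open>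
  The equations \<open>x'' = 2x'y'/y\<close> and \<open>y'' = (y'\<^sup>2 - x'\<^sup>2)/y\<close> combine into one complex equation. In this
  form the invariance under fractional linear maps is a short computation.
\<close>
lemma covariant_acceleration_zero_iff:
  assumes "Im z > 0"
  shows "(\<forall>w. hyp_metric z a w + christoffel z u u w = 0) \<longleftrightarrow> a = - \<i> * u\<^sup>2 / of_real (Im z)"
proof -
  define b where "b = - \<i> * u\<^sup>2 / of_real (Im z)"
  have b: "Re b = 2 * Re u * Im u / Im z" "Im b = ((Im u)\<^sup>2 - (Re u)\<^sup>2) / Im z"
    by (simp_all add: b_def power2_eq_square diff_divide_distrib)
  have "hyp_metric z a w + christoffel z u u w = ((a - b) \<bullet> w) / (Im z)\<^sup>2" for w
    using assms
    by (simp add: christoffel_def metric_deriv_eq hyp_metric_def inner_complex_def b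
        field_simps power2_eq_square power3_eq_cube)
  then have "(\<forall>w. hyp_metric z a w + christoffel z u u w = 0) \<longleftrightarrow> (\<forall>w. (a - b) \<bullet> w = 0)"
    using assms by simp
  also have "\<dots> \<longleftrightarrow> a - b = 0" by (metis inner_eq_zero_iff inner_zero_left)
  finally show ?thesis by (simp only: b_def right_minus_eq)
qed

lemma geodesic_iff:
  "geodesic \<gamma> \<longleftrightarrow> (\<exists>\<gamma>'. \<forall>t. Im (\<gamma> t) > 0 \<and> (\<gamma> has_vector_derivative \<gamma>' t) (at t) \<and>
     (\<gamma>' has_vector_derivative - \<i> * (\<gamma>' t)\<^sup>2 / of_real (Im (\<gamma> t))) (at t) \<and>
     cmod (\<gamma>' t) = Im (\<gamma> t))"
proof -
  have n: "hyp_metric z w w = 1 \<longleftrightarrow> cmod w = Im z" if "Im z > 0" for z w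
    using unit_tangent_bundle_iff[of z w] that
    by (auto simp: unit_tangent_bundle_def unit_tangent_at_def upper_half_plane_def)
  show ?thesis
  proof
    assume "geodesic \<gamma>"
    then obtain u a where h: "\<And>t. Im (\<gamma> t) > 0" "\<And>t. (\<gamma> has_vector_derivative u t) (at t)"
      "\<And>t. (u has_vector_derivative a t) (at t)" "\<And>t. hyp_metric (\<gamma> t) (u t) (u t) = 1"
      "\<And>t w. hyp_metric (\<gamma> t) (a t) w + christoffel (\<gamma> t) (u t) (u t) w = 0"
      unfolding geodesic_def upper_half_plane_def by auto
    have "a t = - \<i> * (u t)\<^sup>2 / of_real (Im (\<gamma> t))" for t
      using h(5)[of t] covariant_acceleration_zero_iff[OF h(1)] by blast
    then show "\<exists>\<gamma>'. \<forall>t. Im (\<gamma> t) > 0 \<and> (\<gamma> has_vector_derivative \<gamma>' t) (at t) \<and>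
       (\<gamma>' has_vector_derivative - \<i> * (\<gamma>' t)\<^sup>2 / of_real (Im (\<gamma> t))) (at t) \<and>
       cmod (\<gamma>' t) = Im (\<gamma> t)"
      using h n[OF h(1)] by (intro exI[of _ u]) metis
  next
    assume "\<exists>\<gamma>'. \<forall>t. Im (\<gamma> t) > 0 \<and> (\<gamma> has_vector_derivative \<gamma>' t) (at t) \<and>
       (\<gamma>' has_vector_derivative - \<i> * (\<gamma>' t)\<^sup>2 / of_real (Im (\<gamma> t))) (at t) \<and>
       cmod (\<gamma>' t) = Im (\<gamma> t)"
    then obtain u where h: "\<And>t. Im (\<gamma> t) > 0" "\<And>t. (\<gamma> has_vector_derivative u t) (at t)"
      "\<And>t. (u has_vector_derivative - \<i> * (u t)\<^sup>2 / of_real (Im (\<gamma> t))) (at t)"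
      "\<And>t. cmod (u t) = Im (\<gamma> t)"
      by auto
    have "\<forall>w. hyp_metric (\<gamma> t) (- \<i> * (u t)\<^sup>2 / of_real (Im (\<gamma> t))) w +
        christoffel (\<gamma> t) (u t) (u t) w = 0" for t
      by (subst covariant_acceleration_zero_iff[OF h(1)]) (rule refl)
    then show "geodesic \<gamma>"
      unfolding geodesic_def upper_half_plane_def using h n[OF h(1)]
      by (intro exI[of _ u] exI[of _ "\<lambda>t. - \<i> * (u t)\<^sup>2 / of_real (Im (\<gamma> t))"]) auto
  qed
qed

lemma geodesicD:
  assumes "geodesic \<gamma>"
  shows "Im (\<gamma> t) > 0"
    and "(\<gamma> has_vector_derivative snd (tangent \<gamma> t)) (at t)"
    and "((\<lambda>t. snd (tangent \<gamma> t)) has_vector_derivative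
           - \<i> * (snd (tangent \<gamma> t))\<^sup>2 / of_real (Im (\<gamma> t))) (at t)"
    and "cmod (snd (tangent \<gamma> t)) = Im (\<gamma> t)"
proof -
  obtain \<gamma>' where g: "\<And>t. Im (\<gamma> t) > 0 \<and> (\<gamma> has_vector_derivative \<gamma>' t) (at t) \<and>
     (\<gamma>' has_vector_derivative - \<i> * (\<gamma>' t)\<^sup>2 / of_real (Im (\<gamma> t))) (at t) \<and>
     cmod (\<gamma>' t) = Im (\<gamma> t)"
    using assms by (auto simp: geodesic_iff)
  have s: "(\<lambda>t. snd (tangent \<gamma> t)) = \<gamma>'"
    using g by (auto simp: tangent_def intro!: vector_derivative_at)
  have s': "snd (tangent \<gamma> t) = \<gamma>' t" using fun_cong[OF s] .
  show "Im (\<gamma> t) > 0"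
    and "(\<gamma> has_vector_derivative snd (tangent \<gamma> t)) (at t)"
    and "((\<lambda>t. snd (tangent \<gamma> t)) has_vector_derivative
           - \<i> * (snd (tangent \<gamma> t))\<^sup>2 / of_real (Im (\<gamma> t))) (at t)"
    and "cmod (snd (tangent \<gamma> t)) = Im (\<gamma> t)"
    unfolding s s' using g by auto
qed

lemma tangent_eq:
  assumes "(\<gamma> has_vector_derivative w) (at t)"
  shows "tangent \<gamma> t = (\<gamma> t, w)"
  using assms by (simp add: tangent_def vector_derivative_at)

lemma tangent_in_bundle: "geodesic \<gamma> \<Longrightarrow> tangent \<gamma> t \<in> unit_tangent_bundle"
  using geodesicD(1,4)[of \<gamma> t] unit_tangent_bundle_iff[of "\<gamma> t" "snd (tangent \<gamma> t)"]
  by (simp add: tangent_def)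

text \<open>Covers time shifts (\<open>\<sigma> = 1\<close>) and reversal of orientation (\<open>\<sigma> = -1\<close>, \<open>s = 0\<close>) at once.\<close>
lemma geodesic_affine:
  assumes "geodesic \<gamma>" "\<sigma>\<^sup>2 = 1"
  shows "geodesic (\<lambda>t. \<gamma> (\<sigma> * t + s))" (is "geodesic ?\<delta>")
    and "tangent (\<lambda>t. \<gamma> (\<sigma> * t + s)) t = (\<gamma> (\<sigma> * t + s), \<sigma> *\<^sub>R snd (tangent \<gamma> (\<sigma> * t + s)))"
proof -
  define u where "u = (\<lambda>t. snd (tangent \<gamma> t))"
  note g = geodesicD[OF assms(1), folded u_def]
  have aff: "((\<lambda>t. \<sigma> * t + s) has_vector_derivative \<sigma>) (at t)" for t
    unfolding has_real_derivative_iff_has_vector_derivative[symmetric]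
    by (auto intro!: derivative_eq_intros)
  have d1: "(?\<delta> has_vector_derivative \<sigma> *\<^sub>R u (\<sigma> * t + s)) (at t)" for t
    using vector_diff_chain_at[OF aff g(2)] by (simp add: o_def u_def)
  have "((\<lambda>t. u (\<sigma> * t + s)) has_vector_derivative
      \<sigma> *\<^sub>R (- \<i> * (u (\<sigma> * t + s))\<^sup>2 / of_real (Im (\<gamma> (\<sigma> * t + s))))) (at t)" for t
    using vector_diff_chain_at[OF aff g(3)] by (simp add: o_def u_def)
  then have "((\<lambda>t. \<sigma> *\<^sub>R u (\<sigma> * t + s)) has_vector_derivative
      \<sigma> *\<^sub>R \<sigma> *\<^sub>R (- \<i> * (u (\<sigma> * t + s))\<^sup>2 / of_real (Im (\<gamma> (\<sigma> * t + s))))) (at t)" for t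
    by (rule bounded_linear.has_vector_derivative[OF bounded_linear_scaleR_right])
  moreover have "\<sigma> *\<^sub>R \<sigma> *\<^sub>R (- \<i> * v\<^sup>2 / y) = - \<i> * (\<sigma> *\<^sub>R v)\<^sup>2 / y" for v y :: complex
    using assms(2) by (simp add: scaleR_conv_of_real power_mult_distrib flip: of_real_power)
       (metis mult.assoc mult_1 of_real_1 of_real_mult power2_eq_square)
  ultimately have d2: "((\<lambda>t. \<sigma> *\<^sub>R u (\<sigma> * t + s)) has_vector_derivative
      - \<i> * (\<sigma> *\<^sub>R u (\<sigma> * t + s))\<^sup>2 / of_real (Im (?\<delta> t))) (at t)" for t
    by simp
  have "\<bar>\<sigma>\<bar> = 1" using assms(2) by (simp add: power2_eq_1_iff) auto
  then have "cmod (\<sigma> *\<^sub>R u (\<sigma> * t + s)) = Im (?\<delta> t)" for t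
    using g(4)[of "\<sigma> * t + s"] by (simp add: u_def)
  then show "geodesic ?\<delta>"
    unfolding geodesic_iff using d1 d2 g(1)
    by (intro exI[of _ "\<lambda>t. \<sigma> *\<^sub>R u (\<sigma> * t + s)"]) simp
  show "tangent ?\<delta> t = (\<gamma> (\<sigma> * t + s), \<sigma> *\<^sub>R snd (tangent \<gamma> (\<sigma> * t + s)))"
    using tangent_eq[OF d1] by (simp add: u_def)
qed

lemma geodesic_shift:
  assumes "geodesic \<gamma>"
  shows "geodesic (\<lambda>t. \<gamma> (t + s))" "tangent (\<lambda>t. \<gamma> (t + s)) t = tangent \<gamma> (t + s)"
  using geodesic_affine[OF assms, of 1 s] by (simp_all add: tangent_def)

lemma geodesic_reverse:
  assumes "geodesic \<gamma>"
  shows "geodesic (\<lambda>t. \<gamma> (- t))"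
    "tangent (\<lambda>t. \<gamma> (- t)) t = (\<gamma> (- t), - snd (tangent \<gamma> (- t)))"
  using geodesic_affine[OF assms, of "-1" 0] by simp_all

lemma geodesic_moebius:
  assumes "det A = 1" "geodesic \<gamma>"
  shows "geodesic (moebius A \<circ> \<gamma>)"
    and "tangent (moebius A \<circ> \<gamma>) t = moebius_tangent A (tangent \<gamma> t)"
proof -
  define u where "u = (\<lambda>t. snd (tangent \<gamma> t))"
  note g = geodesicD[OF assms(2), folded u_def]
  have nz: "automorphy A (\<gamma> t) \<noteq> 0" for t by (rule automorphy_nonzero[OF assms(1) g(1)])
  have Im: "Im (moebius A (\<gamma> t)) = Im (\<gamma> t) / (cmod (automorphy A (\<gamma> t)))\<^sup>2" for t
    by (rule Im_moebius[OF assms(1) g(1)])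
  have d1: "((moebius A \<circ> \<gamma>) has_vector_derivative u t / (automorphy A (\<gamma> t))\<^sup>2) (at t)" for t
    using field_vector_diff_chain_at[OF g(2) moebius_has_derivative[OF assms(1) g(1)]]
    by (simp add: u_def)
  have dautomorphy: "(automorphy A has_field_derivative of_int (A $ 2 $ 1)) (at z)" for z
    unfolding automorphy_def[abs_def] by (auto intro!: derivative_eq_intros)
  have "((\<lambda>z. 1 / (automorphy A z)\<^sup>2) has_field_derivative - 2 * of_int (A $ 2 $ 1) / (automorphy A (\<gamma> t)) ^ 3)
      (at (\<gamma> t))" for t
    by (rule DERIV_cong[OF DERIV_divide[OF DERIV_const DERIV_power[OF dautomorphy]]])
      (use nz[of t] in \<open>simp_all add: field_simps power2_eq_square power3_eq_cube\<close>)
  from field_vector_diff_chain_at[OF g(2) this]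
  have "((\<lambda>t. 1 / (automorphy A (\<gamma> t))\<^sup>2) has_vector_derivative
      u t * (- 2 * of_int (A $ 2 $ 1) / (automorphy A (\<gamma> t)) ^ 3)) (at t)" for t
    by (simp add: o_def u_def)
  from has_vector_derivative_mult[OF g(3)[folded u_def] this]
  have d2: "((\<lambda>t. u t / (automorphy A (\<gamma> t))\<^sup>2) has_vector_derivative
     u t * (u t * (- 2 * of_int (A $ 2 $ 1) / (automorphy A (\<gamma> t)) ^ 3)) +
     - \<i> * (u t)\<^sup>2 / of_real (Im (\<gamma> t)) / (automorphy A (\<gamma> t))\<^sup>2) (at t)" for t
    by (simp add: u_def)
  have "u t * (u t * (- 2 * of_int (A $ 2 $ 1) / (automorphy A (\<gamma> t)) ^ 3)) +
     - \<i> * (u t)\<^sup>2 / of_real (Im (\<gamma> t)) / (automorphy A (\<gamma> t))\<^sup>2 =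
     - \<i> * (u t / (automorphy A (\<gamma> t))\<^sup>2)\<^sup>2 / of_real (Im (moebius A (\<gamma> t)))" for t
  proof -
    define j where "j = automorphy A (\<gamma> t)"
    define c where "c = (of_int (A $ 2 $ 1) :: complex)"
    define y where "y = complex_of_real (Im (\<gamma> t))"
    have y: "y \<noteq> 0" using g(1)[of t] by (simp add: y_def)
    have j: "j \<noteq> 0" using nz by (simp add: j_def)
    \<comment> \<open>The term from differentiating the factor \<open>1/j\<^sup>2\<close> is exactly what turns one \<open>j\<close> into its conjugate.\<close>
    have cj: "cnj j = j - 2 * \<i> * c * y"
      by (simp add: j_def c_def y_def automorphy_def complex_eq_iff)
    have m: "of_real (Im (moebius A (\<gamma> t))) = y / (j * cnj j)"
      by (simp add: Im j_def y_def complex_norm_square flip: of_real_power)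
    have "- \<i> * (u t / j\<^sup>2)\<^sup>2 / of_real (Im (moebius A (\<gamma> t))) = - \<i> * (u t)\<^sup>2 * cnj j / (y * j ^ 3)"
      unfolding m using y j by (simp add: field_simps power2_eq_square power3_eq_cube)
    also have "\<dots> = u t * (u t * (- 2 * c / j ^ 3)) + - \<i> * (u t)\<^sup>2 / y / j\<^sup>2"
      using y j by (simp add: cj field_simps power2_eq_square power3_eq_cube)
    finally show ?thesis by (simp add: j_def c_def y_def)
  qed
  with d2 have d2: "((\<lambda>t. u t / (automorphy A (\<gamma> t))\<^sup>2) has_vector_derivative
     - \<i> * (u t / (automorphy A (\<gamma> t))\<^sup>2)\<^sup>2 / of_real (Im ((moebius A \<circ> \<gamma>) t))) (at t)" for t
    by simp
  have n: "cmod (u t / (automorphy A (\<gamma> t))\<^sup>2) = Im ((moebius A \<circ> \<gamma>) t)" for t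
    using g(4)[of t] by (simp add: Im norm_divide norm_power u_def)
  have p: "Im ((moebius A \<circ> \<gamma>) t) > 0" for t
    using Im_moebius_pos[OF assms(1) g(1)] by simp
  show "geodesic (moebius A \<circ> \<gamma>)"
    unfolding geodesic_iff using d1 d2 n p
    by (intro exI[of _ "\<lambda>t. u t / (automorphy A (\<gamma> t))\<^sup>2"]) simp
  show "tangent (moebius A \<circ> \<gamma>) t = moebius_tangent A (tangent \<gamma> t)"
    using tangent_eq[OF d1] moebius_tangent_eq[OF assms(1) g(1)]
    by (simp add: u_def tangent_def)
qed

text \<open>The equation \<open>F'' = F\<close> factors, so \<open>(F + F') exp (-t)\<close> and \<open>(F - F') exp t\<close> are constant.\<close>
lemma linear_ode_exp:
  fixes F F' :: "real \<Rightarrow> real"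
  assumes "\<And>t. (F has_real_derivative F' t) (at t)"
    and "\<And>t. (F' has_real_derivative F t) (at t)"
  shows "F t = (F 0 + F' 0) / 2 * exp t + (F 0 - F' 0) / 2 * exp (- t)"
proof -
  have "((\<lambda>t. (F t + F' t) * exp (- t)) has_real_derivative 0) (at s)" for s
    using assms by (auto intro!: derivative_eq_intros simp: algebra_simps)
  then have 1: "(F t + F' t) * exp (- t) = F 0 + F' 0"
    using DERIV_const_ratio_const[of 0 t] DERIV_isconst_all[of "\<lambda>t. (F t + F' t) * exp (- t)" t 0] by simp
  have "((\<lambda>t. (F t - F' t) * exp t) has_real_derivative 0) (at s)" for s
    using assms by (auto intro!: derivative_eq_intros simp: algebra_simps)
  then have 2: "(F t - F' t) * exp t = F 0 - F' 0"
    using DERIV_isconst_all[of "\<lambda>t. (F t - F' t) * exp t" t 0] by simp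
  have "F t + F' t = (F 0 + F' 0) * exp t"
    using 1 by (simp add: exp_minus field_simps)
  moreover have "F t - F' t = (F 0 - F' 0) * exp (- t)"
    using 2 by (simp add: exp_minus field_simps)
  ultimately show ?thesis by (simp add: field_simps)
qed

text \<open>
  The functions \<open>1/y\<close>, \<open>x/y\<close> are linear coordinates of the hyperboloid model restricted to the
  geodesic. There geodesics are plane sections, and so both satisfy \<open>F'' = F\<close>.
\<close>
lemma geodesic_coordinates:
  assumes "geodesic \<gamma>" "tangent \<gamma> 0 = (z, w)"
  shows "1 / Im (\<gamma> t) =
      (Im z - Im w) / (2 * (Im z)\<^sup>2) * exp t + (Im z + Im w) / (2 * (Im z)\<^sup>2) * exp (- t)"
    and "Re (\<gamma> t) / Im (\<gamma> t) =
      (Re z * Im z + Re w * Im z - Re z * Im w) / (2 * (Im z)\<^sup>2) * exp t +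
      (Re z * Im z - Re w * Im z + Re z * Im w) / (2 * (Im z)\<^sup>2) * exp (- t)"
proof -
  define u where "u = (\<lambda>t. snd (tangent \<gamma> t))"
  note g = geodesicD[OF assms(1), folded u_def]
  have z: "\<gamma> 0 = z" "u 0 = w" using assms(2) by (simp_all add: tangent_def u_def)
  have y0: "Im z > 0" using g(1)[of 0] z by simp
  have yp: "Im (\<gamma> t) \<noteq> 0" for t using g(1)[of t] by simp
  have dx: "((\<lambda>t. Re (\<gamma> t)) has_real_derivative Re (u t)) (at t)"
    and dy: "((\<lambda>t. Im (\<gamma> t)) has_real_derivative Im (u t)) (at t)" for t
    using g(2)[of t] by (auto simp: has_vector_derivative_complex_iff u_def)
  have du: "((\<lambda>t. Re (u t)) has_real_derivative 2 * Re (u t) * Im (u t) / Im (\<gamma> t)) (at t)"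
    and dv: "((\<lambda>t. Im (u t)) has_real_derivative ((Im (u t))\<^sup>2 - (Re (u t))\<^sup>2) / Im (\<gamma> t)) (at t)" for t
  proof -
    have r: "Re (- \<i> * (u t)\<^sup>2 / of_real (Im (\<gamma> t))) = 2 * Re (u t) * Im (u t) / Im (\<gamma> t)"
      and i: "Im (- \<i> * (u t)\<^sup>2 / of_real (Im (\<gamma> t))) = ((Im (u t))\<^sup>2 - (Re (u t))\<^sup>2) / Im (\<gamma> t)"
      by (simp_all add: power2_eq_square diff_divide_distrib)
    have "(u has_vector_derivative - \<i> * (u t)\<^sup>2 / of_real (Im (\<gamma> t))) (at t)"
      using g(3)[of t] by (simp add: u_def)
    then show "((\<lambda>t. Re (u t)) has_real_derivative 2 * Re (u t) * Im (u t) / Im (\<gamma> t)) (at t)"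
      "((\<lambda>t. Im (u t)) has_real_derivative ((Im (u t))\<^sup>2 - (Re (u t))\<^sup>2) / Im (\<gamma> t)) (at t)"
      unfolding has_vector_derivative_complex_iff r i by auto
  qed
  have n: "(Re (u t))\<^sup>2 + (Im (u t))\<^sup>2 = (Im (\<gamma> t))\<^sup>2" for t
    using g(4)[of t] by (simp add: u_def flip: cmod_power2)
  have n': "Re (u t) * Re (u t) = Im (\<gamma> t) * Im (\<gamma> t) - Im (u t) * Im (u t)" for t
    using n[of t] by (simp add: power2_eq_square)
  have 1: "((\<lambda>t. 1 / Im (\<gamma> t)) has_real_derivative - Im (u t) / (Im (\<gamma> t))\<^sup>2) (at t)" for t
    by (rule DERIV_cong[OF DERIV_divide[OF DERIV_const dy yp]]) (simp add: power2_eq_square)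
  have 2: "((\<lambda>t. - Im (u t) / (Im (\<gamma> t))\<^sup>2) has_real_derivative 1 / Im (\<gamma> t)) (at t)" for t
    by (rule DERIV_cong[OF DERIV_divide[OF DERIV_minus[OF dv] DERIV_power[OF dy]]])
      (use yp[of t] in \<open>simp_all add: field_simps power2_eq_square n'\<close>)
  show "1 / Im (\<gamma> t) =
      (Im z - Im w) / (2 * (Im z)\<^sup>2) * exp t + (Im z + Im w) / (2 * (Im z)\<^sup>2) * exp (- t)"
    using linear_ode_exp[OF 1 2, of t] y0 by (simp add: z field_simps power2_eq_square)
  have 3: "((\<lambda>t. Re (\<gamma> t) / Im (\<gamma> t)) has_real_derivative
      Re (u t) / Im (\<gamma> t) - Re (\<gamma> t) * Im (u t) / (Im (\<gamma> t))\<^sup>2) (at t)" for t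
    by (rule DERIV_cong[OF DERIV_divide[OF dx dy yp]])
      (use yp[of t] in \<open>simp add: field_simps power2_eq_square\<close>)
  have 4: "((\<lambda>t. Re (u t) / Im (\<gamma> t) - Re (\<gamma> t) * Im (u t) / (Im (\<gamma> t))\<^sup>2) has_real_derivative
      Re (\<gamma> t) / Im (\<gamma> t)) (at t)" for t
    by (rule DERIV_cong[OF DERIV_diff[OF DERIV_divide[OF du dy yp]
          DERIV_divide[OF DERIV_mult[OF dx dv] DERIV_power[OF dy]]]])
      (use yp[of t] in \<open>simp_all add: field_simps power2_eq_square n'\<close>)
  show "Re (\<gamma> t) / Im (\<gamma> t) =
      (Re z * Im z + Re w * Im z - Re z * Im w) / (2 * (Im z)\<^sup>2) * exp t +
      (Re z * Im z - Re w * Im z + Re z * Im w) / (2 * (Im z)\<^sup>2) * exp (- t)"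
    using linear_ode_exp[OF 3 4, of t] y0 by (simp add: z field_simps power2_eq_square)
qed

lemma geodesic_exponential_coordinates:
  assumes "geodesic \<gamma>"
  obtains a b c d where "\<And>t. 1 / Im (\<gamma> t) = a * exp t + b * exp (- t)"
    and "\<And>t. Re (\<gamma> t) / Im (\<gamma> t) = c * exp t + d * exp (- t)"
proof -
  obtain z w where zw: "tangent \<gamma> 0 = (z, w)" by (cases "tangent \<gamma> 0")
  show ?thesis
    by (rule that) (rule geodesic_coordinates[OF assms zw])+
qed

lemma geodesic_unique:
  assumes "geodesic \<gamma>" "geodesic \<delta>" "tangent \<gamma> 0 = tangent \<delta> 0"
  shows "\<gamma> = \<delta>"
proof
  fix t
  obtain z w where zw: "tangent \<delta> 0 = (z, w)" by (cases "tangent \<delta> 0")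
  have zw': "tangent \<gamma> 0 = (z, w)" using zw assms(3) by simp
  have i: "1 / Im (\<gamma> t) = 1 / Im (\<delta> t)"
    unfolding geodesic_coordinates(1)[OF assms(1) zw'] geodesic_coordinates(1)[OF assms(2) zw] ..
  have r: "Re (\<gamma> t) / Im (\<gamma> t) = Re (\<delta> t) / Im (\<delta> t)"
    unfolding geodesic_coordinates(2)[OF assms(1) zw'] geodesic_coordinates(2)[OF assms(2) zw] ..
  show "\<gamma> t = \<delta> t"
    using i r geodesicD(1)[OF assms(1), of t] by (simp add: complex_eq_iff)
qed

text \<open>
  With \<open>f = 1/y\<close> and \<open>g = x/y\<close> prescribed by their initial values, \<open>(g + \<i>)/f\<close> is the geodesic. The
  Wronskian \<open>W = g'f - gf'\<close> is constant, and the initial speed gives \<open>W\<^sup>2 = f\<^sup>2 - f'\<^sup>2\<close>; this relation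
  is both the unit speed condition and the geodesic equation.
\<close>
lemma geodesic_exists:
  assumes "(z, w) \<in> unit_tangent_bundle"
  obtains \<gamma> where "geodesic \<gamma>" "tangent \<gamma> 0 = (z, w)"
proof -
  have y0: "Im z > 0" and nw: "cmod w = Im z" using assms by (auto simp: unit_tangent_bundle_iff)
  define a where "a = (Im z - Im w) / (2 * (Im z)\<^sup>2)"
  define b where "b = (Im z + Im w) / (2 * (Im z)\<^sup>2)"
  define c where "c = (Re z * Im z + Re w * Im z - Re z * Im w) / (2 * (Im z)\<^sup>2)"
  define d where "d = (Re z * Im z - Re w * Im z + Re z * Im w) / (2 * (Im z)\<^sup>2)"
  define f where "f = (\<lambda>t. a * exp t + b * exp (- t))"
  define f' where "f' = (\<lambda>t. a * exp t - b * exp (- t))"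
  define g where "g = (\<lambda>t. c * exp t + d * exp (- t))"
  define W where "W = 2 * (c * b - a * d)"
  have "\<bar>Im w\<bar> \<le> Im z" using abs_Im_le_cmod[of w] nw by simp
  then have ab: "a \<ge> 0" "b \<ge> 0" by (simp_all add: a_def b_def)
  have sum: "a + b = 1 / Im z" using y0 by (simp add: a_def b_def field_simps power2_eq_square)
  have pos: "f t > 0" for t
  proof -
    have "a > 0 \<or> b > 0" using ab sum y0 by (smt (verit) divide_pos_pos)
    then show ?thesis unfolding f_def using ab by (auto intro: add_pos_nonneg add_nonneg_pos)
  qed
  have WRe: "W = Re w / (Im z)\<^sup>2"
    unfolding W_def a_def b_def c_def d_def using y0 by (simp add: field_simps power2_eq_square)
  have "(Re w)\<^sup>2 = (Im z)\<^sup>2 - (Im w)\<^sup>2" using nw cmod_power2[of w] by simp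
  then have W: "W\<^sup>2 = 4 * a * b"
    unfolding WRe a_def b_def using y0 by (simp add: power_divide) (simp add: field_simps power2_eq_square)
  have ff: "(f t)\<^sup>2 = W\<^sup>2 + (f' t)\<^sup>2" for t
  proof -
    have "exp t * exp (- t) = 1" by (simp flip: exp_add)
    then have "(f t)\<^sup>2 - (f' t)\<^sup>2 = 4 * a * b"
      unfolding f_def f'_def by (simp add: power2_eq_square algebra_simps)
    then show ?thesis using W by simp
  qed
  define \<gamma> where "\<gamma> = (\<lambda>t. Complex (g t / f t) (1 / f t))"
  define u where "u = (\<lambda>t. Complex (W / (f t)\<^sup>2) (- f' t / (f t)\<^sup>2))"
  have fn: "f t \<noteq> 0" for t using pos[of t] by simp
  have df: "(f has_real_derivative f' t) (at t)" "(f' has_real_derivative f t) (at t)" for t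
    unfolding f_def f'_def by (auto intro!: derivative_eq_intros)
  have dg: "(g has_real_derivative c * exp t - d * exp (- t)) (at t)" for t
    unfolding g_def by (auto intro!: derivative_eq_intros)
  have wr: "(c * exp t - d * exp (- t)) * f t - g t * f' t = W" for t
  proof -
    have "exp t * exp (- t) = 1" by (simp flip: exp_add)
    then show ?thesis unfolding g_def f_def f'_def W_def by (simp add: algebra_simps)
  qed
  have d1: "(\<gamma> has_vector_derivative u t) (at t)" for t
  proof -
    have "((\<lambda>t. g t / f t) has_real_derivative W / (f t)\<^sup>2) (at t)"
      unfolding power2_eq_square wr[of t, symmetric] by (rule DERIV_divide[OF dg df(1) fn])
    moreover have "((\<lambda>t. 1 / f t) has_real_derivative - f' t / (f t)\<^sup>2) (at t)"
      using DERIV_divide[OF DERIV_const df(1) fn, of 1] by (simp add: power2_eq_square)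
    ultimately show ?thesis
      by (simp add: has_vector_derivative_complex_iff \<gamma>_def u_def)
  qed
  have d2: "(u has_vector_derivative - \<i> * (u t)\<^sup>2 / of_real (Im (\<gamma> t))) (at t)" for t
  proof -
    have "((\<lambda>t. W / (f t)\<^sup>2) has_real_derivative - 2 * W * f' t / (f t) ^ 3) (at t)"
      by (rule DERIV_cong[OF DERIV_divide[OF DERIV_const DERIV_power[OF df(1)]]])
        (use fn[of t] in \<open>simp_all add: field_simps power2_eq_square power3_eq_cube\<close>)
    moreover have "((\<lambda>t. - f' t / (f t)\<^sup>2) has_real_derivative ((f' t)\<^sup>2 - W\<^sup>2) / (f t) ^ 3) (at t)"
    proof -
      have e: "(f' t)\<^sup>2 - W\<^sup>2 = 2 * (f' t)\<^sup>2 - (f t)\<^sup>2" using ff[of t] by simp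
      show ?thesis
        unfolding e
        by (rule DERIV_cong[OF DERIV_divide[OF DERIV_minus[OF df(2)] DERIV_power[OF df(1)]]])
          (use fn[of t] in \<open>simp_all add: field_simps power2_eq_square power3_eq_cube\<close>)
    qed
    moreover have "Re (- \<i> * (u t)\<^sup>2 / of_real (Im (\<gamma> t))) = - 2 * W * f' t / (f t) ^ 3"
      using fn[of t] by (simp add: u_def \<gamma>_def power2_eq_square field_simps power3_eq_cube)
    moreover have "Im (- \<i> * (u t)\<^sup>2 / of_real (Im (\<gamma> t))) = ((f' t)\<^sup>2 - W\<^sup>2) / (f t) ^ 3"
      using fn[of t] by (simp add: u_def \<gamma>_def power2_eq_square field_simps power3_eq_cube)
    ultimately show ?thesis
      by (simp add: has_vector_derivative_complex_iff u_def)
  qed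
  have nu: "cmod (u t) = Im (\<gamma> t)" for t
  proof -
    have "(cmod (u t))\<^sup>2 = (W\<^sup>2 + (f' t)\<^sup>2) / ((f t)\<^sup>2)\<^sup>2"
      unfolding cmod_power2 u_def by (simp add: power_divide add_divide_distrib)
    also have "\<dots> = (1 / f t)\<^sup>2"
      unfolding ff[symmetric] using fn[of t] by (simp add: power2_eq_square)
    finally show ?thesis using pos[of t] by (simp add: \<gamma>_def power2_eq_iff_nonneg)
  qed
  have "geodesic \<gamma>"
    unfolding geodesic_iff using d1 d2 nu pos by (auto simp: \<gamma>_def intro!: exI[of _ u])
  moreover have "tangent \<gamma> 0 = (z, w)"
  proof -
    have f0: "f 0 = 1 / Im z" "f' 0 = - Im w / (Im z)\<^sup>2" "g 0 = Re z / Im z"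
      using y0 unfolding f_def f'_def g_def a_def b_def c_def d_def
      by (simp_all add: field_simps power2_eq_square)
    show ?thesis
      using y0 unfolding tangent_eq[OF d1]
      by (simp add: \<gamma>_def u_def f0 WRe complex_eq_iff) (simp add: field_simps power2_eq_square)
  qed
  ultimately show ?thesis using that by blast
qed

lemma geodesic_of:
  assumes "v \<in> unit_tangent_bundle"
  shows "geodesic (geodesic_of v)" "tangent (geodesic_of v) 0 = v"
proof -
  obtain \<gamma> where "geodesic \<gamma>" "tangent \<gamma> 0 = v"
    using geodesic_exists[of "fst v" "snd v"] assms by auto
  then have "\<exists>!\<gamma>. geodesic \<gamma> \<and> tangent \<gamma> 0 = v" using geodesic_unique by metis
  from theI'[OF this] show "geodesic (geodesic_of v)" "tangent (geodesic_of v) 0 = v"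
    unfolding geodesic_of_def by auto
qed

lemma geodesic_of_eq:
  assumes "geodesic \<gamma>" "tangent \<gamma> 0 = v"
  shows "geodesic_of v = \<gamma>"
  using assms geodesic_of[of v] geodesic_unique tangent_in_bundle[OF assms(1), of 0] by metis

section \<open>The flow on the quotient\<close>

lemma proj_tangent_moebius:
  assumes "A \<in> Gamma0 p" "geodesic \<gamma>"
  shows "proj p (tangent (moebius A \<circ> \<gamma>) t) = proj p (tangent \<gamma> t)"
  using geodesic_moebius(2)[OF Gamma0_det[OF assms(1)] assms(2)]
    proj_moebius_tangent[OF assms(1) tangent_in_bundle[OF assms(2)]] by simp

lemma geodesic_in_class:
  assumes "geodesic \<gamma>"
  shows "\<gamma> \<in> geodesic_class p \<gamma>"
proof -
  have "moebius (mat 1) \<circ> \<gamma> = \<gamma>" by (simp add: fun_eq_iff)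
  then show ?thesis unfolding geodesic_class_def using Gamma0_one[of p] by force
qed

lemma tangentY_class:
  assumes "geodesic \<gamma>"
  shows "tangentY p (geodesic_class p \<gamma>) t = proj p (tangent \<gamma> t)"
  unfolding tangentY_def
proof (rule the_equality)
  show "\<exists>\<delta>\<in>geodesic_class p \<gamma>. proj p (tangent \<gamma> t) = proj p (tangent \<delta> t)"
    using geodesic_in_class[OF assms] by blast
next
  fix u assume "\<exists>\<delta>\<in>geodesic_class p \<gamma>. u = proj p (tangent \<delta> t)"
  then show "u = proj p (tangent \<gamma> t)"
    using proj_tangent_moebius[OF _ assms] by (auto simp: geodesic_class_def)
qed

lemma time_shift_class: "time_shift s (geodesic_class p \<gamma>) = geodesic_class p (\<lambda>t. \<gamma> (t + s))"
  by (auto simp: time_shift_def geodesic_class_def image_image o_def)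

lemma geodesic_of_moebius:
  assumes "A \<in> Gamma0 p" "v \<in> unit_tangent_bundle"
  shows "geodesic_of (moebius_tangent A v) = moebius A \<circ> geodesic_of v"
  using geodesic_moebius[OF Gamma0_det[OF assms(1)] geodesic_of(1)[OF assms(2)]]
  by (intro geodesic_of_eq) (simp_all add: geodesic_of(2)[OF assms(2)])

lemma flowY_proj:
  assumes "v \<in> unit_tangent_bundle"
  shows "flowY p t (proj p v) = proj p (geodesic_flow t v)"
  unfolding flowY_def
proof (rule the_equality)
  show "\<exists>u\<in>unit_tangent_bundle. proj p v = proj p u \<and>
      proj p (geodesic_flow t v) = proj p (geodesic_flow t u)"
    using assms by blast
next
  fix q assume "\<exists>u\<in>unit_tangent_bundle. proj p v = proj p u \<and> q = proj p (geodesic_flow t u)"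
  then obtain u where u: "u \<in> unit_tangent_bundle" "proj p v = proj p u"
    "q = proj p (geodesic_flow t u)" by blast
  then obtain A where A: "A \<in> Gamma0 p" "u = moebius_tangent A v"
    using proj_eq_iff[OF u(1) assms, of p] by auto
  show "q = proj p (geodesic_flow t v)"
    using proj_tangent_moebius[OF A(1) geodesic_of(1)[OF assms]]
    by (simp add: u(3) A(2) geodesic_flow_def geodesic_of_moebius[OF A(1) assms])
qed

section \<open>Cuspidal geodesics\<close>

text \<open>
  For coprime \<open>(c, d)\<close> this is the inverse of the height of \<open>z\<close> seen from the cusp \<open>-d/c\<close>, and its
  level sets are the horocycles there.
\<close>
definition horo :: "int \<Rightarrow> int \<Rightarrow> complex \<Rightarrow> real" where
  "horo c d z = (cmod (of_int c * z + of_int d))\<^sup>2 / Im z"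

text \<open>
  Running into a cusp is expressed by the height instead of the limit point. In this form it
  includes the cusp at infinity and is visibly invariant under \<open>SL(2,\<int>)\<close>.
\<close>
definition cuspidal :: "(real \<Rightarrow> complex) \<Rightarrow> bool" where
  "cuspidal \<gamma> \<longleftrightarrow> (\<exists>c d. (c, d) \<noteq> (0, 0) \<and> ((\<lambda>t. horo c d (\<gamma> t)) \<longlongrightarrow> 0) at_top)"

lemma horo_moebius:
  assumes "det A = 1" "Im z > 0"
  shows "horo c d (moebius A z) =
    horo (c * A $ 1 $ 1 + d * A $ 2 $ 1) (c * A $ 1 $ 2 + d * A $ 2 $ 2) z"
proof -
  have nz: "automorphy A z \<noteq> 0" by (rule automorphy_nonzero[OF assms])
  have "(of_int c * moebius A z + of_int d) * automorphy A z =
    of_int (c * A $ 1 $ 1 + d * A $ 2 $ 1) * z + of_int (c * A $ 1 $ 2 + d * A $ 2 $ 2)"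
    using nz by (simp add: moebius_automorphy field_simps) (simp add: automorphy_def algebra_simps)
  then have "cmod (of_int (c * A $ 1 $ 1 + d * A $ 2 $ 1) * z + of_int (c * A $ 1 $ 2 + d * A $ 2 $ 2)) =
      cmod (of_int c * moebius A z + of_int d) * cmod (automorphy A z)"
    by (metis norm_mult)
  then show ?thesis
    unfolding horo_def Im_moebius[OF assms] by (simp only: power_mult_distrib divide_divide_eq_right)
qed

text \<open>The row vector \<open>(c, d)\<close> is multiplied by an invertible matrix.\<close>
lemma unimodular_row_nonzero:
  fixes A :: "int ^ 2 ^ 2"
  assumes "det A = 1" "(c, d) \<noteq> (0, 0)"
  shows "(c * A $ 1 $ 1 + d * A $ 2 $ 1, c * A $ 1 $ 2 + d * A $ 2 $ 2) \<noteq> (0, 0)"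
proof
  assume "(c * A $ 1 $ 1 + d * A $ 2 $ 1, c * A $ 1 $ 2 + d * A $ 2 $ 2) = (0, 0)"
  then have h: "c * A $ 1 $ 1 + d * A $ 2 $ 1 = 0" "c * A $ 1 $ 2 + d * A $ 2 $ 2 = 0" by auto
  have D: "A $ 1 $ 1 * A $ 2 $ 2 - A $ 1 $ 2 * A $ 2 $ 1 = 1" using assms(1) by (simp add: det_2)
  have "c = c * (A $ 1 $ 1 * A $ 2 $ 2 - A $ 1 $ 2 * A $ 2 $ 1)" by (simp add: D)
  also have "\<dots> = (c * A $ 1 $ 1 + d * A $ 2 $ 1) * A $ 2 $ 2 - (c * A $ 1 $ 2 + d * A $ 2 $ 2) * A $ 2 $ 1"
    by (simp add: algebra_simps)
  finally have "c = 0" by (simp add: h)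
  have "d = d * (A $ 1 $ 1 * A $ 2 $ 2 - A $ 1 $ 2 * A $ 2 $ 1)" by (simp add: D)
  also have "\<dots> = (c * A $ 1 $ 2 + d * A $ 2 $ 2) * A $ 1 $ 1 - (c * A $ 1 $ 1 + d * A $ 2 $ 1) * A $ 1 $ 2"
    by (simp add: algebra_simps)
  finally have "d = 0" by (simp add: h)
  with \<open>c = 0\<close> assms(2) show False by simp
qed

lemma cuspidal_moebius:
  assumes "det A = 1" "geodesic \<gamma>" "cuspidal (\<lambda>t. moebius A (\<gamma> t))"
  shows "cuspidal \<gamma>"
proof -
  obtain c d where "(c, d) \<noteq> (0, 0)" "((\<lambda>t. horo c d (moebius A (\<gamma> t))) \<longlongrightarrow> 0) at_top"
    using assms(3) by (auto simp: cuspidal_def)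
  then show ?thesis
    unfolding cuspidal_def horo_moebius[OF assms(1) geodesicD(1)[OF assms(2)]]
    using unimodular_row_nonzero[OF assms(1)] by blast
qed

lemma cuspidal_shift:
  assumes "cuspidal \<gamma>"
  shows "cuspidal (\<lambda>t. \<gamma> (t + s))"
proof -
  obtain c d where cd: "(c, d) \<noteq> (0, 0)" "((\<lambda>t. horo c d (\<gamma> t)) \<longlongrightarrow> 0) at_top"
    using assms by (auto simp: cuspidal_def)
  have "filterlim (\<lambda>t::real. t + s) at_top at_top"
    using filterlim_tendsto_add_at_top[OF tendsto_const[of s] filterlim_ident] by (simp add: add.commute)
  from filterlim_compose[OF cd(2) this] show ?thesis
    using cd(1) by (auto simp: cuspidal_def)
qed

lemma exp_minus_tendsto_0: "((\<lambda>t::real. exp (- t)) \<longlongrightarrow> 0) at_top"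
  by (rule filterlim_compose[OF exp_at_bot filterlim_uminus_at_bot_at_top])

text \<open>
  By uniqueness the geodesic is the vertical line over \<open>k/p\<close>. It ends at infinity or at \<open>k/p\<close>,
  according to its orientation.
\<close>
lemma vertical_tangent_cuspidal:
  fixes k p :: int
  assumes "geodesic \<gamma>" "p \<noteq> 0" "Re (\<gamma> t) = k / p" "Re (snd (tangent \<gamma> t)) = 0"
  shows "cuspidal \<gamma>"
proof -
  define \<delta> where "\<delta> = (\<lambda>s. \<gamma> (s + t))"
  have g: "geodesic \<delta>" and t0: "tangent \<delta> 0 = (\<gamma> t, snd (tangent \<gamma> t))"
    using geodesic_shift[OF assms(1), of t] by (simp_all add: \<delta>_def tangent_def)
  define y where "y = Im (\<gamma> t)"
  have y: "y > 0" using geodesicD(1)[OF assms(1)] by (simp add: y_def)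
  define e where "e = Im (snd (tangent \<gamma> t))"
  have "cmod (snd (tangent \<gamma> t)) = y" using geodesicD(4)[OF assms(1)] by (simp add: y_def)
  then have "\<bar>e\<bar> = y" using assms(4) by (simp add: cmod_eq_Im e_def)
  then have e: "e = y \<or> e = - y" by auto
  have I: "1 / Im (\<delta> s) = (y - e) / (2 * y\<^sup>2) * exp s + (y + e) / (2 * y\<^sup>2) * exp (- s)"
    and R: "Re (\<delta> s) / Im (\<delta> s) = k / p * (1 / Im (\<delta> s))" for s
    using geodesic_coordinates[OF g t0, of s] assms(3,4) by (simp_all add: y_def e_def algebra_simps)
  have pos: "Im (\<delta> s) > 0" for s by (rule geodesicD(1)[OF g])
  have "cuspidal \<delta>"
    using e
  proof
    assume "e = y"
    then have "1 / Im (\<delta> s) = exp (- s) / y" for s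
      using I[of s] y by (simp add: field_simps power2_eq_square)
    then have "(\<lambda>s. horo 0 1 (\<delta> s)) = (\<lambda>s. exp (- s) / y)" by (simp add: horo_def)
    moreover have "((\<lambda>s. exp (- s) / y) \<longlongrightarrow> 0 / y) at_top"
      by (intro tendsto_intros exp_minus_tendsto_0) (use y in simp)
    ultimately show ?thesis unfolding cuspidal_def
      by (intro exI[of _ 0] exI[of _ 1]) simp
  next
    assume "e = - y"
    then have "1 / Im (\<delta> s) = exp s / y" for s
      using I[of s] y by (simp add: field_simps power2_eq_square)
    then have Im: "Im (\<delta> s) = y * exp (- s)" for s
      using y by (simp add: field_simps exp_minus) (metis nonzero_eq_divide_eq exp_not_eq_zero mult.commute pos less_irrefl)
    have Re: "Re (\<delta> s) = k / p" for s
      using R[of s] pos[of s] by (simp add: field_simps)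
    have "horo p (- k) (\<delta> s) = p\<^sup>2 * (y * exp (- s))" for s
    proof -
      have "of_int p * \<delta> s + of_int (- k) = Complex 0 (p * Im (\<delta> s))"
        using assms(2) by (simp add: complex_eq_iff Re)
      then have "horo p (- k) (\<delta> s) = (p * Im (\<delta> s))\<^sup>2 / Im (\<delta> s)"
        by (simp add: horo_def complex_norm)
      also have "\<dots> = p\<^sup>2 * (y * exp (- s))"
        using pos[of s] by (simp add: Im power2_eq_square)
      finally show ?thesis .
    qed
    moreover have "((\<lambda>s. p\<^sup>2 * (y * exp (- s))) \<longlongrightarrow> p\<^sup>2 * (y * 0)) at_top"
      by (intro tendsto_intros exp_minus_tendsto_0)
    ultimately show ?thesis unfolding cuspidal_def
      using assms(2) by (intro exI[of _ p] exI[of _ "-k"]) simp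
  qed
  from cuspidal_shift[OF this, of "- t"] show ?thesis by (simp add: \<delta>_def)
qed

text \<open>
  In the coordinates \<open>1/y = a exp t + b exp (-t)\<close> and \<open>x/y = c exp t + d exp (-t)\<close> the forward endpoint
  is \<open>c/a\<close>. If \<open>a = 0\<close> the geodesic goes up to infinity, and if \<open>c/a\<close> is the rational \<open>m/n\<close> then the
  leading terms cancel in \<open>n x/y - m/y\<close>, which forces the inverse height at \<open>m/n\<close> to decay.
\<close>
lemma noncuspidal_endpoint:
  assumes "geodesic \<gamma>" "\<not> cuspidal \<gamma>"
  obtains \<xi> where "\<xi> \<notin> \<rat>" "((\<lambda>t. Re (\<gamma> t)) \<longlongrightarrow> \<xi>) at_top" "((\<lambda>t. Im (\<gamma> t)) \<longlongrightarrow> 0) at_top"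
proof -
  have pos: "Im (\<gamma> t) > 0" for t by (rule geodesicD(1)[OF assms(1)])
  obtain a b c d where I: "\<And>t. 1 / Im (\<gamma> t) = a * exp t + b * exp (- t)"
    and R: "\<And>t. Re (\<gamma> t) / Im (\<gamma> t) = c * exp t + d * exp (- t)"
    using geodesic_exponential_coordinates[OF assms(1)] by blast
  have "a \<noteq> 0"
  proof
    assume "a = 0"
    then have "horo 0 1 (\<gamma> t) = b * exp (- t)" for t using I[of t] by (simp add: horo_def)
    moreover have "((\<lambda>s. b * exp (- s)) \<longlongrightarrow> b * 0) at_top"
      by (intro tendsto_intros exp_minus_tendsto_0)
    ultimately have "cuspidal \<gamma>" unfolding cuspidal_def
      by (intro exI[of _ 0] exI[of _ 1]) simp
    then show False using assms(2) by simp
  qed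
  define E where "E = (\<lambda>t::real. exp (- t))"
  have E0: "(E \<longlongrightarrow> 0) at_top" unfolding E_def by (rule exp_minus_tendsto_0)
  have Ep: "E t > 0" for t by (simp add: E_def)
  define h where "h = (\<lambda>t. a + b * (E t)\<^sup>2)"
  have h: "h t = E t / Im (\<gamma> t)" for t
  proof -
    have "E t * (1 / Im (\<gamma> t)) = h t"
      unfolding I h_def E_def by (simp add: algebra_simps power2_eq_square flip: exp_add)
    then show ?thesis by simp
  qed
  have hl: "(h \<longlongrightarrow> a) at_top"
  proof -
    have "(h \<longlongrightarrow> a + b * 0\<^sup>2) at_top" unfolding h_def by (intro tendsto_intros E0)
    then show ?thesis by simp
  qed
  have hn: "h t \<noteq> 0" for t using h[of t] Ep[of t] pos[of t] by simp
  have Im: "Im (\<gamma> t) = E t / h t" for t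
    using h[of t] hn[of t] pos[of t] by (simp add: field_simps)
  have Re: "Re (\<gamma> t) = (c + d * (E t)\<^sup>2) / h t" for t
  proof -
    have "c + d * (E t)\<^sup>2 = E t * (Re (\<gamma> t) / Im (\<gamma> t))"
      unfolding R E_def by (simp add: algebra_simps power2_eq_square flip: exp_add)
    then show ?thesis using pos[of t] Ep[of t] unfolding h by simp
  qed
  have "c / a \<notin> \<rat>"
  proof
    assume "c / a \<in> \<rat>"
    then obtain m n :: int where mn: "n > 0" "c / a = m / n"
      by (auto elim: Rats_cases')
    then have ca: "n * c = m * a" using \<open>a \<noteq> 0\<close> by (simp add: field_simps)
    define q where "q = n * d - m * b"
    have "horo n (- m) (\<gamma> t) = (q\<^sup>2 * (E t)^3 + (real_of_int n)\<^sup>2 * E t) / h t" for t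
    proof -
      have r: "Re (of_int n * \<gamma> t + of_int (- m)) = q * (E t)\<^sup>2 / h t"
      proof -
        have "n * (c + d * (E t)\<^sup>2) - m * h t = q * (E t)\<^sup>2"
          using ca by (simp add: h_def q_def algebra_simps)
        then show ?thesis using hn[of t] by (simp add: Re field_simps)
      qed
      have i: "Im (of_int n * \<gamma> t + of_int (- m)) = n * E t / h t"
        by (simp add: Im)
      show ?thesis
        unfolding horo_def cmod_power2 r i using hn[of t] Ep[of t]
        by (simp add: Im field_simps power2_eq_square power3_eq_cube)
    qed
    moreover have "((\<lambda>t. (q\<^sup>2 * (E t)^3 + (real_of_int n)\<^sup>2 * E t) / h t) \<longlongrightarrow> (q\<^sup>2 * 0^3 + (real_of_int n)\<^sup>2 * 0) / a) at_top"
      by (intro tendsto_intros E0 hl \<open>a \<noteq> 0\<close>)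
    ultimately have "cuspidal \<gamma>" unfolding cuspidal_def
      using mn(1) by (intro exI[of _ n] exI[of _ "- m"]) simp
    then show False using assms(2) by simp
  qed
  moreover have "((\<lambda>t. Re (\<gamma> t)) \<longlongrightarrow> (c + d * 0\<^sup>2) / a) at_top"
    unfolding Re by (intro tendsto_intros E0 hl \<open>a \<noteq> 0\<close>)
  moreover have "((\<lambda>t. Im (\<gamma> t)) \<longlongrightarrow> 0 / a) at_top"
    unfolding Im by (intro tendsto_intros E0 hl \<open>a \<noteq> 0\<close>)
  ultimately show ?thesis using that by simp
qed

section \<open>Crossing the Farey tessellation\<close>

text \<open>
  Repeatedly replacing an endpoint by the mediant \<open>(a + c)/(b + d)\<close> keeps the determinant, and
  \<open>b + d\<close> grows by at least one in each step. The length of the interval is \<open>1/(bd)\<close>.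
\<close>
lemma farey_interval:
  fixes \<xi> :: real and n :: nat
  assumes "\<xi> \<notin> \<rat>"
  obtains a b c d :: int where "b > 0" "d > 0" "b * c - a * d = 1"
    "a < b * \<xi>" "d * \<xi> < c" "b + d \<ge> int n"
proof -
  have ne: "of_int q * \<xi> \<noteq> of_int m" if "q \<noteq> 0" for q m :: int
  proof
    assume "of_int q * \<xi> = of_int m"
    then have "\<xi> = of_int m / of_int q" using that by (simp add: field_simps)
    then show False using assms by auto
  qed
  have "\<exists>(a::int) (b::int) (c::int) (d::int). b > 0 \<and> d > 0 \<and> b * c - a * d = 1 \<and>
      real_of_int a < real_of_int b * \<xi> \<and> real_of_int d * \<xi> < real_of_int c \<and> b + d \<ge> int n"
  proof (induction n)
    case 0
    have "of_int \<lfloor>\<xi>\<rfloor> \<noteq> \<xi>" using ne[of 1 "\<lfloor>\<xi>\<rfloor>"] by (metis mult_1 of_int_1 zero_neq_one)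
    then have "of_int \<lfloor>\<xi>\<rfloor> < \<xi>" using of_int_floor_le[of \<xi>] by linarith
    moreover have "\<xi> < of_int (\<lfloor>\<xi>\<rfloor> + 1)" by linarith
    ultimately show ?case
      by - (rule exI[of _ "\<lfloor>\<xi>\<rfloor>"], rule exI[of _ 1], rule exI[of _ "\<lfloor>\<xi>\<rfloor> + 1"],
          rule exI[of _ 1], simp)
  next
    case (Suc n)
    then obtain a b c d :: int where h: "b > 0" "d > 0" "b * c - a * d = 1"
      "a < b * \<xi>" "d * \<xi> < c" "b + d \<ge> int n" by blast
    have "of_int (a + c) < of_int (b + d) * \<xi> \<or> of_int (b + d) * \<xi> < of_int (a + c)"
      using ne[of "b + d" "a + c"] h(1,2) by linarith
    then show ?case
    proof
      assume "of_int (a + c) < of_int (b + d) * \<xi>"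
      then show ?case using h
        by (intro exI[of _ "a + c"] exI[of _ "b + d"] exI[of _ c] exI[of _ d])
          (auto simp: algebra_simps)
    next
      assume "of_int (b + d) * \<xi> < of_int (a + c)"
      then show ?case using h
        by (intro exI[of _ a] exI[of _ b] exI[of _ "a + c"] exI[of _ "b + d"])
          (auto simp: algebra_simps)
    qed
  qed
  then show ?thesis using that by blast
qed

text \<open>
  The equation says that \<open>pz\<close> lies on the geodesic from \<open>a/b\<close> to \<open>c/d\<close>. The matrix
  \<open>(b, -a; -d, c)\<close> moves this geodesic to the imaginary axis with \<open>c/d\<close> going to infinity. After
  conjugation with the scaling by \<open>p\<close>, membership in the group requires the upper right entry to be
  divisible by \<open>p\<close>. A translation by \<open>k\<close> changes this entry to \<open>kc - a\<close>, so a suitable \<open>k\<close> exists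
  unless \<open>p\<close> divides \<open>c\<close>; in that case the matrix \<open>(d, -c; b, -a)\<close>, which sends the other endpoint
  \<open>a/b\<close> to infinity, already satisfies the condition.
\<close>
lemma farey_edge_equivalent_to_vertical:
  fixes p :: nat and a b c d :: int
  assumes "prime p" "b * c - a * d = 1"
  obtains A and k :: nat where "A \<in> Gamma0 p" "k \<le> p"
    "\<And>z. Im z > 0 \<Longrightarrow> Re ((of_int b * (of_nat p * z) - of_int a) * cnj (of_int d * (of_nat p * z) - of_int c)) = 0
       \<Longrightarrow> Re (moebius A z) = k / p"
proof (cases "int p dvd c")
  case True
  then obtain m where m: "c = int p * m" by (elim dvdE)
  define A where "A = mat2 d (- m) (b * int p) (- a)"
  show ?thesis
  proof (rule that)
    show "A \<in> Gamma0 p" using assms(2) by (simp add: A_def Gamma0_def m algebra_simps)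
    show "(0::nat) \<le> p" by simp
  next
    fix z assume z: "Im z > 0"
      and r: "Re ((of_int b * (of_nat p * z) - of_int a) * cnj (of_int d * (of_nat p * z) - of_int c)) = 0"
    define U where "U = of_int b * (of_nat p * z) - of_int a"
    define V where "V = of_int d * (of_nat p * z) - of_int c"
    have r': "Re (U * cnj V) = 0" using r unfolding U_def V_def .
    have "moebius A z * of_nat p = V / U"
      by (simp add: moebius_def A_def U_def V_def m algebra_simps)
    from arg_cong[OF this, of Re] have "Re (moebius A z) * p = Re (V / U)" by simp
    also have "\<dots> = 0" using r' by (simp add: Re_divide mult.commute)
    finally show "Re (moebius A z) = real 0 / real p"
      using assms(1) prime_gt_0_nat by simp
  qed
next
  case False
  then have "coprime c (int p)"
    using assms(1) prime_imp_coprime[of "int p" c] by (simp add: coprime_commute)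
  then obtain c' q where c': "c' * c + q * int p = 1"
    using bezout_int[of c "int p"] by auto
  define k where "k = nat ((a * c') mod int p)"
  have p0: "p > 0" using assms(1) prime_gt_0_nat by simp
  have k: "int k = (a * c') mod int p" using p0 by (simp add: k_def)
  have "int k * c - a = a * (c' * c - 1) - int p * ((a * c') div int p) * c"
    unfolding k minus_mult_div_eq_mod[symmetric] by (simp add: algebra_simps)
  also have "c' * c - 1 = - q * int p" using c' by simp
  finally have "int k * c - a = int p * (- a * q - (a * c') div int p * c)"
    by (simp add: algebra_simps)
  then have "int p dvd int k * c - a" by (rule dvdI)
  then obtain m where m: "int k * c - a = int p * m" by (elim dvdE)
  define A where "A = mat2 (b - int k * d) m (- d * int p) c"
  show ?thesis
  proof (rule that)
    have "(b - int k * d) * c + d * (int p * m) = 1"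
      unfolding m[symmetric] using assms(2) by (simp add: algebra_simps)
    then show "A \<in> Gamma0 p" by (simp add: A_def Gamma0_def algebra_simps)
    have "int k < int p" unfolding k using p0 by simp
    then show "k \<le> p" by simp
  next
    fix z assume z: "Im z > 0"
      and r: "Re ((of_int b * (of_nat p * z) - of_int a) * cnj (of_int d * (of_nat p * z) - of_int c)) = 0"
    define U where "U = of_int b * (of_nat p * z) - of_int a"
    define V where "V = of_int d * (of_nat p * z) - of_int c"
    have r': "Re (U * cnj V) = 0" using r unfolding U_def V_def .
    have V: "V \<noteq> 0"
    proof -
      have "(d, - c) \<noteq> (0, 0)" using assms(2) by auto
      then show ?thesis
        using int_lin_nonzero[of "of_nat p * z" d "- c"] z p0 by (simp add: V_def)
    qed
    have m': "of_nat k * of_int c - of_int a = (of_nat p * of_int m :: complex)"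
      using arg_cong[OF m, of "of_int :: int \<Rightarrow> complex"] by simp
    have "moebius A z = (of_int (b - int k * d) * z + of_int m) / (- V)"
      by (simp add: moebius_def A_def V_def algebra_simps)
    moreover have "of_nat p * (of_int (b - int k * d) * z + of_int m) = U - of_nat k * V"
      unfolding distrib_left m'[symmetric] by (simp add: U_def V_def algebra_simps)
    ultimately have "of_nat p * moebius A z = (U - of_nat k * V) / (- V)"
      by (metis times_divide_eq_right)
    also have "\<dots> = of_nat k - U / V" using V by (simp add: field_simps)
    finally have "Re (of_nat p * moebius A z) = Re (of_nat k - U / V)" by (rule arg_cong)
    then have "p * Re (moebius A z) = k - Re (U / V)" by simp
    also have "Re (U / V) = 0" using r' by (simp add: Re_divide)
    finally show "Re (moebius A z) = real k / real p"
      using p0 by (simp add: field_simps)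
  qed
qed

text \<open>
  At time \<open>T\<close> the point lies above any sufficiently small semicircle around the endpoint, and at late
  times it lies inside. The function \<open>\<phi>\<close> is positive outside and negative inside the semicircle
  from \<open>a/b\<close> to \<open>c/d\<close>.
\<close>
lemma noncuspidal_crosses:
  fixes p :: nat
  assumes "prime p" "geodesic \<gamma>" "\<not> cuspidal \<gamma>"
  obtains t A and k :: nat where "t \<ge> T" "A \<in> Gamma0 p" "k \<le> p" "Re (moebius A (\<gamma> t)) = k / p"
proof -
  obtain \<xi> where xi: "\<xi> \<notin> \<rat>" "((\<lambda>t. Re (\<gamma> t)) \<longlongrightarrow> \<xi>) at_top" "((\<lambda>t. Im (\<gamma> t)) \<longlongrightarrow> 0) at_top"
    using noncuspidal_endpoint[OF assms(2,3)] .
  have p0: "p > 0" using assms(1) prime_gt_0_nat by simp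
  have pxi: "p * \<xi> \<notin> \<rat>"
  proof
    assume "p * \<xi> \<in> \<rat>"
    then have "p * \<xi> / p \<in> \<rat>" by (intro Rats_divide) auto
    then show False using xi(1) p0 by simp
  qed
  have pos: "Im (\<gamma> t) > 0" for t by (rule geodesicD(1)[OF assms(2)])
  define Y where "Y = p * Im (\<gamma> T)"
  have Y: "Y > 0" using pos p0 by (simp add: Y_def)
  obtain n :: nat where n: "1 / Y + 1 < n" using reals_Archimedean2 by blast
  obtain a b c d :: int where F: "b > 0" "d > 0" "b * c - a * d = 1"
    "a < b * (p * \<xi>)" "d * (p * \<xi>) < c" "b + d \<ge> int n"
    using farey_interval[OF pxi] .
  define \<phi> where "\<phi> = (\<lambda>t. (b * (p * Re (\<gamma> t)) - a) * (d * (p * Re (\<gamma> t)) - c) + of_int b * of_int d * (p * Im (\<gamma> t))\<^sup>2)"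
  have \<phi>: "\<phi> t = Re ((of_int b * (of_nat p * \<gamma> t) - of_int a) * cnj (of_int d * (of_nat p * \<gamma> t) - of_int c))" for t
    by (simp add: \<phi>_def power2_eq_square algebra_simps)
  have "(\<phi> \<longlongrightarrow> (b * (p * \<xi>) - a) * (d * (p * \<xi>) - c) + of_int b * of_int d * (real p * 0)\<^sup>2) at_top"
    unfolding \<phi>_def by (intro tendsto_intros xi)
  moreover have "(b * (p * \<xi>) - a) * (d * (p * \<xi>) - c) + of_int b * of_int d * (real p * 0)\<^sup>2 < 0"
    using F(4,5) by (simp add: mult_pos_neg)
  ultimately have "eventually (\<lambda>t. \<phi> t < 0) at_top" by (rule order_tendstoD)
  with eventually_ge_at_top[of T] have "eventually (\<lambda>t. \<phi> t < 0 \<and> t \<ge> T) at_top"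
    by eventually_elim simp
  then obtain T' where T': "\<phi> T' < 0" "T' \<ge> T" by (auto dest: eventually_happens)
  have "\<phi> T > 0"
  proof -
    define u where "u = b * (p * Re (\<gamma> T)) - a"
    define v where "v = d * (p * Re (\<gamma> T)) - c"
    have "real_of_int b * c - a * d = 1" using F(3) by (metis of_int_1 of_int_diff of_int_mult)
    then have 1: "d * u - b * v = 1" by (simp add: u_def v_def algebra_simps)
    have bd: "real_of_int (b * d) \<ge> real n - 1"
    proof -
      have "(b - 1) * (d - 1) \<ge> 0" using F(1,2) by simp
      then have "b * d \<ge> int n - 1" using F(6) by (simp add: algebra_simps)
      then show ?thesis by linarith
    qed
    have bd0: "real_of_int (b * d) > 0" using F(1,2) by simp
    have "1 < (real n - 1) * Y" using n Y by (simp add: field_simps)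
    also have "\<dots> \<le> (b * d) * Y" by (rule mult_right_mono[OF bd]) (use Y in simp)
    finally have big: "1 < ((b * d) * Y)\<^sup>2" by (simp add: power2_eq_square less_1_mult)
    \<comment> \<open>The determinant condition makes \<open>d u - b v = 1\<close>, so only the height has to be estimated.\<close>
    have "4 * (b * d) * (u * v + b * d * Y\<^sup>2) = (d * u + b * v)\<^sup>2 - (d * u - b * v)\<^sup>2 + 4 * ((b * d) * Y)\<^sup>2"
      by (simp add: power2_eq_square algebra_simps)
    also have "\<dots> > 0" using big zero_le_power2[of "d * u + b * v"] unfolding 1 power_one by linarith
    finally have "u * v + b * d * Y\<^sup>2 > 0"
      by (rule zero_less_mult_pos) (use bd0 in simp)
    then show ?thesis by (simp add: \<phi>_def u_def v_def Y_def)
  qed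
  have "isCont \<gamma> t" for t
    using geodesicD(2)[OF assms(2)] by (rule has_vector_derivative_continuous)
  then have "continuous_on {T..T'} \<phi>"
    unfolding \<phi>_def by (intro continuous_intros continuous_at_imp_continuous_on) auto
  from IVT2'[of \<phi> T' 0 T, OF _ _ T'(2) this] T'(1) \<open>\<phi> T > 0\<close>
  obtain t where t: "t \<ge> T" "\<phi> t = 0" by auto
  obtain A and k :: nat where A: "A \<in> Gamma0 p" "k \<le> p"
    "\<And>z. Im z > 0 \<Longrightarrow> Re ((of_int b * (of_nat p * z) - of_int a) * cnj (of_int d * (of_nat p * z) - of_int c)) = 0
       \<Longrightarrow> Re (moebius A z) = k / p"
    using farey_edge_equivalent_to_vertical[OF assms(1) F(3)] by blast
  show ?thesis
    by (rule that[OF t(1) A(1,2)]) (use A(3)[OF pos] t(2) \<phi> in simp)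
qed

lemma C_hat_iff:
  "u \<in> C_hat p \<longleftrightarrow> (\<exists>(k::nat) y w. k \<le> p \<and> y > 0 \<and> cmod w = y \<and> u = proj p (Complex (k / p) y, w) \<and>
     u \<noteq> proj p (Complex (k / p) y, y *\<^sub>R \<i>) \<and> u \<noteq> proj p (Complex (k / p) y, - (y *\<^sub>R \<i>)))"
proof -
  have "unit_tangent_at (Complex x y) = {(Complex x y, w) |w. cmod w = y}" if "y > 0" for x y
    using that unit_tangent_bundle_iff[of "Complex x y"]
    by (auto simp: unit_tangent_bundle_def unit_tangent_at_def upper_half_plane_def)
  moreover have im: "u \<in> proj p ` {(z, w) |w. cmod w = y} - {a, b} \<longleftrightarrow>
      (\<exists>w. cmod w = y \<and> u = proj p (z, w) \<and> u \<noteq> a \<and> u \<noteq> b)" for z y a b by blast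
  ultimately have "u \<in> C_hat p \<longleftrightarrow> (\<exists>k\<in>{0..p}. \<exists>y\<in>{0<..}. u \<in> proj p ` {(Complex (k / p) y, w) |w. cmod w = y} -
     {proj p (Complex (k / p) y, y *\<^sub>R \<i>), proj p (Complex (k / p) y, - (y *\<^sub>R \<i>))})"
    by (simp add: C_hat_def Let_def)
  also have "\<dots> \<longleftrightarrow> (\<exists>(k::nat) y w. k \<le> p \<and> y > 0 \<and> cmod w = y \<and> u = proj p (Complex (k / p) y, w) \<and>
     u \<noteq> proj p (Complex (k / p) y, y *\<^sub>R \<i>) \<and> u \<noteq> proj p (Complex (k / p) y, - (y *\<^sub>R \<i>)))"
    unfolding im by (simp add: Bex_def)
  finally show ?thesis .
qed

text \<open>
  The removed vectors are excluded as orbits, so a crossing vector could be lost for a second reason: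
  an elliptic element fixing the crossing point may rotate it into the vertical direction. In both
  cases the geodesic is equivalent to a vertical line and hence cuspidal.
\<close>
lemma noncuspidal_crossing_in_C_hat:
  fixes p k :: nat
  assumes "p > 0" "geodesic \<gamma>" "\<not> cuspidal \<gamma>" "A \<in> Gamma0 p" "k \<le> p"
    and "Re (moebius A (\<gamma> t)) = k / p"
  shows "proj p (tangent \<gamma> t) \<in> C_hat p"
proof -
  define y where "y = Im (moebius A (\<gamma> t))"
  define z where "z = Complex (k / p) y"
  have pos: "Im (\<gamma> t) > 0" by (rule geodesicD(1)[OF assms(2)])
  have y: "y > 0" using Im_moebius_pos[OF Gamma0_det[OF assms(4)] pos] by (simp add: y_def)
  have z: "moebius A (\<gamma> t) = z" using assms(6) by (simp add: z_def y_def complex_eq_iff)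
  define w where "w = snd (tangent (moebius A \<circ> \<gamma>) t)"
  have tw: "tangent (moebius A \<circ> \<gamma>) t = (z, w)" by (simp add: w_def tangent_def z)
  have u: "proj p (tangent \<gamma> t) = proj p (z, w)"
    using proj_tangent_moebius[OF assms(4,2), of t] tw by simp
  have w: "cmod w = y"
    using geodesicD(4)[OF geodesic_moebius(1)[OF Gamma0_det[OF assms(4)] assms(2)], of t]
    by (simp add: w_def y_def)
  have nv: "proj p (tangent \<gamma> t) \<noteq> proj p (z, w')" if "Re w' = 0" "cmod w' = y" for w'
  proof
    assume e: "proj p (tangent \<gamma> t) = proj p (z, w')"
    have "(z, w') \<in> unit_tangent_bundle" using that y by (simp add: unit_tangent_bundle_iff z_def)
    from proj_eq_iff[OF this tangent_in_bundle[OF assms(2), of t], of p] e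
    obtain B where B: "B \<in> Gamma0 p" "(z, w') = moebius_tangent B (tangent \<gamma> t)" by auto
    have d: "det B = 1" by (rule Gamma0_det[OF B(1)])
    have g: "geodesic (moebius B \<circ> \<gamma>)" and tB: "tangent (moebius B \<circ> \<gamma>) t = (z, w')"
      using geodesic_moebius[OF d assms(2)] B(2) by auto
    have "cuspidal (moebius B \<circ> \<gamma>)"
    proof (rule vertical_tangent_cuspidal[OF g, of "int p" t "int k"])
      show "int p \<noteq> 0" using assms(1) by simp
      show "Re ((moebius B \<circ> \<gamma>) t) = real_of_int (int k) / real_of_int (int p)"
        using arg_cong[OF tB, of fst] by (simp add: tangent_def z_def)
      show "Re (snd (tangent (moebius B \<circ> \<gamma>) t)) = 0" using tB that(1) by simp
    qed
    then show False using cuspidal_moebius[OF d assms(2)] assms(3) by (simp add: o_def)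
  qed
  show ?thesis
    unfolding C_hat_iff
  proof (intro exI conjI)
    show "k \<le> p" by fact
    show "y > 0" by fact
    show "cmod w = y" by fact
    show "proj p (tangent \<gamma> t) = proj p (Complex (k / p) y, w)" using u by (simp add: z_def)
    show "proj p (tangent \<gamma> t) \<noteq> proj p (Complex (k / p) y, y *\<^sub>R \<i>)"
      using nv[of "y *\<^sub>R \<i>"] y by (simp add: z_def norm_mult)
    show "proj p (tangent \<gamma> t) \<noteq> proj p (Complex (k / p) y, - (y *\<^sub>R \<i>))"
      using nv[of "- (y *\<^sub>R \<i>)"] y by (simp add: z_def norm_mult)
  qed
qed

lemma noncuspidal_infinitely_often_future:
  assumes "prime p" "geodesic \<gamma>" "\<not> cuspidal \<gamma>"
  shows "infinitely_often_future p (C_hat p) (geodesic_class p \<gamma>)"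
proof -
  have "\<exists>t\<ge>real n. proj p (tangent \<gamma> t) \<in> C_hat p" for n :: nat
  proof -
    obtain t A and k :: nat where "t \<ge> real n" "A \<in> Gamma0 p" "k \<le> p" "Re (moebius A (\<gamma> t)) = k / p"
      using noncuspidal_crosses[OF assms] .
    then show ?thesis
      using noncuspidal_crossing_in_C_hat[OF prime_gt_0_nat[OF assms(1)] assms(2,3)] by blast
  qed
  then obtain t where t: "\<And>n::nat. t n \<ge> real n \<and> proj p (tangent \<gamma> (t n)) \<in> C_hat p" by metis
  have "filterlim t at_top sequentially"
    by (rule filterlim_at_top_mono[OF filterlim_real_sequentially]) (use t in auto)
  then show ?thesis
    unfolding infinitely_often_future_def tangentY_class[OF assms(2)] using t by blast
qed

lemma noncuspidal_infinitely_often_past: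
  assumes "prime p" "geodesic \<gamma>" "\<not> cuspidal \<gamma>" "\<not> cuspidal (\<lambda>t. \<gamma> (- t))"
  shows "infinitely_often_past p (C_hat p) (geodesic_class p \<gamma>)"
proof -
  have "\<exists>t\<le>- real n. proj p (tangent \<gamma> t) \<in> C_hat p" for n :: nat
  proof -
    obtain t A and k :: nat where "t \<ge> real n" "A \<in> Gamma0 p" "k \<le> p" "Re (moebius A (\<gamma> (- t))) = k / p"
      using noncuspidal_crosses[OF assms(1) geodesic_reverse(1)[OF assms(2)] assms(4)] .
    then show ?thesis
      using noncuspidal_crossing_in_C_hat[OF prime_gt_0_nat[OF assms(1)] assms(2,3), of _ _ "- t"]
      by (intro exI[of _ "- t"]) auto
  qed
  then obtain t where t: "\<And>n::nat. t n \<le> - real n \<and> proj p (tangent \<gamma> (t n)) \<in> C_hat p" by metis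
  have "filterlim (\<lambda>n. - t n) at_top sequentially"
    by (rule filterlim_at_top_mono[OF filterlim_real_sequentially])
      (use t in \<open>auto simp: le_minus_iff\<close>)
  then have "filterlim t at_bot sequentially"
    by (simp add: filterlim_uminus_at_bot)
  then show ?thesis
    unfolding infinitely_often_past_def tangentY_class[OF assms(2)] using t by blast
qed

section \<open>Recurrence\<close>

text \<open>The vectors based high up in some cusp. All cusps of \<open>SL(2,\<int>)\<close> are treated alike.\<close>
definition thin :: "nat \<Rightarrow> real \<Rightarrow> (complex \<times> complex) set set" where
  "thin p \<epsilon> = proj p ` {v \<in> unit_tangent_bundle. \<exists>c d. (c, d) \<noteq> (0, 0) \<and> horo c d (fst v) < \<epsilon>}"

lemma proj_in_thin_iff:
  assumes "v \<in> unit_tangent_bundle"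
  shows "proj p v \<in> thin p \<epsilon> \<longleftrightarrow> (\<exists>c d. (c, d) \<noteq> (0, 0) \<and> horo c d (fst v) < \<epsilon>)"
proof
  assume "proj p v \<in> thin p \<epsilon>"
  then obtain u where u0: "proj p v = proj p u"
    "u \<in> {v \<in> unit_tangent_bundle. \<exists>c d. (c, d) \<noteq> (0, 0) \<and> horo c d (fst v) < \<epsilon>}"
    unfolding thin_def by blast
  then obtain c d where u: "u \<in> unit_tangent_bundle" "proj p u = proj p v"
    "(c, d) \<noteq> (0, 0)" "horo c d (fst u) < \<epsilon>" by auto
  from proj_eq_iff[OF u(1) assms, of p] u(2)
  obtain A where A: "A \<in> Gamma0 p" "u = moebius_tangent A v" by auto
  have pos: "Im (fst v) > 0" using assms unit_tangent_bundle_iff[of "fst v" "snd v"] by simp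
  have "fst u = moebius A (fst v)" by (simp add: A(2) moebius_tangent_def split_beta)
  with u(4) show "\<exists>c d. (c, d) \<noteq> (0, 0) \<and> horo c d (fst v) < \<epsilon>"
    using horo_moebius[OF Gamma0_det[OF A(1)] pos] unimodular_row_nonzero[OF Gamma0_det[OF A(1)] u(3)]
    by metis
next
  assume "\<exists>c d. (c, d) \<noteq> (0, 0) \<and> horo c d (fst v) < \<epsilon>"
  then show "proj p v \<in> thin p \<epsilon>" using assms by (auto simp: thin_def)
qed

lemma thin_measurable: "thin p \<epsilon> \<in> sets (SY_borel p)"
proof -
  define W where "W = (\<Union>(c, d)\<in>UNIV - {(0::int, 0::int)}.
    {v :: complex \<times> complex. (cmod (of_int c * fst v + of_int d))\<^sup>2 < \<epsilon> * Im (fst v)})"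
  have "open W"
    unfolding W_def by (auto intro!: open_UN open_Collect_less continuous_intros)
  have "{v \<in> unit_tangent_bundle. proj p v \<in> thin p \<epsilon>} = unit_tangent_bundle \<inter> W"
  proof -
    have "proj p v \<in> thin p \<epsilon> \<longleftrightarrow> v \<in> W" if "v \<in> unit_tangent_bundle" for v
    proof -
      have "Im (fst v) > 0" using that unit_tangent_bundle_iff[of "fst v" "snd v"] by simp
      then show ?thesis
        unfolding proj_in_thin_iff[OF that] W_def horo_def by (auto simp: pos_divide_less_eq)
    qed
    then show ?thesis by blast
  qed
  then have "openin (top_of_set unit_tangent_bundle) {v \<in> unit_tangent_bundle. proj p v \<in> thin p \<epsilon>}"
    using \<open>open W\<close> by (auto simp: openin_open)
  then have "thin p \<epsilon> \<in> SY_opens p" by (auto simp: SY_opens_def thin_def SY_def)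
  moreover have "SY_opens p \<subseteq> Pow (SY p)" by (auto simp: SY_opens_def)
  ultimately show ?thesis by (simp add: SY_borel_def sets_measure_of)
qed

lemma thin_mono:
  assumes "\<epsilon> \<le> \<epsilon>'"
  shows "thin p \<epsilon> \<subseteq> thin p \<epsilon>'"
proof -
  have "horo c d z < \<epsilon> \<Longrightarrow> horo c d z < \<epsilon>'" for c d z using assms by linarith
  then show ?thesis unfolding thin_def by (intro image_mono) blast
qed

text \<open>A fixed point has bounded height with respect to all cusps, so it leaves the thin part eventually.\<close>
lemma horo_lower_bound:
  assumes "Im z > 0" "(c, d) \<noteq> (0, 0)"
  shows "min (Im z) (1 / Im z) \<le> horo c d z"
proof (cases "c = 0")
  case True
  then have "1 \<le> \<bar>d\<bar>" using assms(2) by simp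
  then have "(1::real) \<le> \<bar>of_int d\<bar>" by linarith
  then have "1 \<le> (real_of_int d)\<^sup>2" using power_mono[of 1 "\<bar>real_of_int d\<bar>" 2] by simp
  then have "1 / Im z \<le> horo c d z"
    using assms(1) True by (simp add: horo_def divide_right_mono)
  then show ?thesis by simp
next
  case False
  then have "1 \<le> \<bar>c\<bar>" by simp
  then have "(1::real) \<le> \<bar>of_int c\<bar>" by linarith
  then have "1 \<le> (real_of_int c)\<^sup>2" using power_mono[of 1 "\<bar>real_of_int c\<bar>" 2] by simp
  then have "1 * (Im z)\<^sup>2 \<le> (real_of_int c)\<^sup>2 * (Im z)\<^sup>2" by (rule mult_right_mono) simp
  also have "\<dots> \<le> (cmod (of_int c * z + of_int d))\<^sup>2"
    by (simp add: cmod_power2 power_mult_distrib)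
  finally have "(Im z)\<^sup>2 / Im z \<le> horo c d z"
    unfolding horo_def using assms(1) by (intro divide_right_mono) auto
  then show ?thesis using assms(1) by (simp add: power2_eq_square)
qed

lemma Inter_thin: "(\<Inter>m::nat. thin p (1 / Suc m)) = {}"
proof (rule ccontr)
  assume "\<not> ?thesis"
  then obtain q where q: "\<And>m::nat. q \<in> thin p (1 / Suc m)" by auto
  from q[of 0] obtain v where v: "v \<in> unit_tangent_bundle" "q = proj p v" by (auto simp: thin_def)
  have pos: "Im (fst v) > 0" using v(1) unit_tangent_bundle_iff[of "fst v" "snd v"] by simp
  then have "min (Im (fst v)) (1 / Im (fst v)) > 0" by simp
  then obtain m where m: "1 / Suc m < min (Im (fst v)) (1 / Im (fst v))"
    by (metis nat_approx_posE)
  from q[of m] obtain c d where "(c, d) \<noteq> (0, 0)" "horo c d (fst v) < 1 / Suc m"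
    unfolding v(2) proj_in_thin_iff[OF v(1)] by auto
  with horo_lower_bound[OF pos, of c d] m show False by linarith
qed

text \<open>
  For each \<open>m\<close>, the points that stay in \<open>A m\<close> from time \<open>N\<close> on lie in the preimage of \<open>A m\<close> at time
  \<open>N\<close>, hence have measure at most that of \<open>A m\<close>, which tends to \<open>0\<close>. Invariance also
  makes the maps \<open>T n\<close> measurable.
\<close>
lemma null_eventually_in_vanishing:
  fixes T :: "nat \<Rightarrow> 'a \<Rightarrow> 'a" and A :: "nat \<Rightarrow> 'a set"
  assumes "prob_space M"
    and A: "\<And>m. A m \<in> sets M" "decseq A" "(\<Inter>m. A m) = {}"
    and T: "\<And>n. T n \<in> space M \<rightarrow> space M"
    and inv: "\<And>n B. B \<in> sets M \<Longrightarrow> emeasure M (T n -` B \<inter> space M) = emeasure M B"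
  shows "{x \<in> space M. \<forall>m. \<exists>N. \<forall>n\<ge>N. T n x \<in> A m} \<in> null_sets M"
proof -
  interpret prob_space M by fact
  \<comment> \<open>Nonmeasurable sets are assigned the value \<open>0\<close>. Either \<open>B\<close> or its complement has positive measure, so
    by invariance one of the two preimages is measurable, and then so is the other.\<close>
  have meas: "T n -` B \<inter> space M \<in> sets M" if B: "B \<in> sets M" for n B
  proof (cases "emeasure M B = 0")
    case False
    then show ?thesis using inv[OF B, of n] emeasure_notin_sets by metis
  next
    case True
    then have "emeasure M (space M - B) = 1"
      using B by (simp add: emeasure_compl emeasure_space_1)
    then have "emeasure M (T n -` (space M - B) \<inter> space M) \<noteq> 0" using inv[of "space M - B" n] B by simp
    then have "T n -` (space M - B) \<inter> space M \<in> sets M" using emeasure_notin_sets by metis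
    then have "space M - (T n -` (space M - B) \<inter> space M) \<in> sets M" by blast
    moreover have "space M - (T n -` (space M - B) \<inter> space M) = T n -` B \<inter> space M"
      using T[of n] by auto
    ultimately show ?thesis by simp
  qed
  define E where "E = (\<lambda>m N. (\<Inter>n\<in>{N..}. T n -` A m \<inter> space M))"
  have E_sets: "E m N \<in> sets M" for m N
    unfolding E_def using meas[OF A(1)] by (intro sets.countable_INT') auto
  have E_le: "emeasure M (\<Union>N. E m N) \<le> emeasure M (A m)" for m
  proof -
    have "incseq (E m)" unfolding E_def incseq_def by auto
    then have "emeasure M (\<Union>N. E m N) = (SUP N. emeasure M (E m N))"
      using E_sets by (intro SUP_emeasure_incseq[symmetric]) auto
    also have "\<dots> \<le> emeasure M (A m)"
    proof (rule SUP_least)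
      fix N
      have "emeasure M (E m N) \<le> emeasure M (T N -` A m \<inter> space M)"
        by (rule emeasure_mono[OF _ meas[OF A(1)]]) (auto simp: E_def)
      then show "emeasure M (E m N) \<le> emeasure M (A m)" using inv[OF A(1)] by simp
    qed
    finally show ?thesis .
  qed
  have D: "{x \<in> space M. \<forall>m. \<exists>N. \<forall>n\<ge>N. T n x \<in> A m} = (\<Inter>m. \<Union>N. E m N)"
  proof -
    have "E m N = {x \<in> space M. \<forall>n\<ge>N. T n x \<in> A m}" for m N
      unfolding E_def by force
    then show ?thesis by simp blast
  qed
  have D_sets: "(\<Inter>m. \<Union>N. E m N) \<in> sets M" using E_sets by auto
  have lim: "(\<lambda>m. emeasure M (A m)) \<longlonglongrightarrow> 0"
    using Lim_emeasure_decseq[of A M] A by auto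
  have "emeasure M (\<Inter>m. \<Union>N. E m N) \<le> emeasure M (A m)" for m
  proof -
    have "emeasure M (\<Inter>m. \<Union>N. E m N) \<le> emeasure M (\<Union>N. E m N)"
      using E_sets by (intro emeasure_mono) auto
    also have "\<dots> \<le> emeasure M (A m)" by (rule E_le)
    finally show ?thesis .
  qed
  then have "emeasure M (\<Inter>m. \<Union>N. E m N) \<le> 0"
    by (intro tendsto_lowerbound[OF lim]) auto
  then show ?thesis unfolding D using D_sets by (auto simp: null_sets_def)
qed

text \<open>The sign of \<open>\<sigma>\<close> distinguishes the geodesics that end in a cusp from those that start in one.\<close>
lemma cuspidal_null:
  assumes "invariant_borel_prob p \<nu>"
  shows "{proj p v | v. v \<in> unit_tangent_bundle \<and> cuspidal (\<lambda>t. geodesic_of v (\<sigma> * t))}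
    \<in> null_sets (completion \<nu>)"
proof -
  have ps: "prob_space \<nu>" and sp: "space \<nu> = SY p" and st: "sets \<nu> = sets (SY_borel p)"
    and inv: "\<And>t A. A \<in> sets \<nu> \<Longrightarrow> emeasure \<nu> (flowY p t -` A \<inter> space \<nu>) = emeasure \<nu> A"
    using assms by (auto simp: invariant_borel_prob_def)
  have flow: "flowY p t \<in> space \<nu> \<rightarrow> space \<nu>" for t
  proof
    fix q assume "q \<in> space \<nu>"
    then obtain v where v: "v \<in> unit_tangent_bundle" "q = proj p v" by (auto simp: sp SY_def)
    show "flowY p t q \<in> space \<nu>"
      unfolding sp SY_def v(2) flowY_proj[OF v(1)] geodesic_flow_def
      using tangent_in_bundle[OF geodesic_of(1)[OF v(1)]] by blast
  qed
  have "{q \<in> space \<nu>. \<forall>m. \<exists>N. \<forall>n\<ge>N. flowY p (\<sigma> * real n) q \<in> thin p (1 / Suc m)} \<in> null_sets \<nu>"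
  proof (rule null_eventually_in_vanishing[OF ps])
    show "thin p (1 / real (Suc m)) \<in> sets \<nu>" for m unfolding st by (rule thin_measurable)
    show "decseq (\<lambda>m. thin p (1 / real (Suc m)))"
      unfolding decseq_def by (intro allI impI thin_mono frac_le) auto
    show "(\<Inter>m. thin p (1 / real (Suc m))) = {}" by (rule Inter_thin)
    show "flowY p (\<sigma> * real n) \<in> space \<nu> \<rightarrow> space \<nu>" for n by (rule flow)
    show "emeasure \<nu> (flowY p (\<sigma> * real n) -` B \<inter> space \<nu>) = emeasure \<nu> B"
      if "B \<in> sets \<nu>" for n B by (rule inv[OF that])
  qed
  moreover have "{proj p v | v. v \<in> unit_tangent_bundle \<and> cuspidal (\<lambda>t. geodesic_of v (\<sigma> * t))} \<subseteq>
    {q \<in> space \<nu>. \<forall>m. \<exists>N. \<forall>n\<ge>N. flowY p (\<sigma> * real n) q \<in> thin p (1 / Suc m)}"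
  proof clarify
    fix v assume v: "v \<in> unit_tangent_bundle" "cuspidal (\<lambda>t. geodesic_of v (\<sigma> * t))"
    then obtain c d where cd: "(c, d) \<noteq> (0, 0)"
      "((\<lambda>t. horo c d (geodesic_of v (\<sigma> * t))) \<longlongrightarrow> 0) at_top" by (auto simp: cuspidal_def)
    show "proj p v \<in> space \<nu> \<and> (\<forall>m. \<exists>N. \<forall>n\<ge>N. flowY p (\<sigma> * real n) (proj p v) \<in> thin p (1 / Suc m))"
    proof (intro conjI allI)
      show "proj p v \<in> space \<nu>" using v(1) by (simp add: sp SY_def)
      fix m
      have "(\<lambda>n. horo c d (geodesic_of v (\<sigma> * real n))) \<longlonglongrightarrow> 0"
        by (rule filterlim_compose[OF cd(2) filterlim_real_sequentially])
      then have "eventually (\<lambda>n. horo c d (geodesic_of v (\<sigma> * real n)) < 1 / Suc m) sequentially"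
        by (rule order_tendstoD) simp
      then obtain N where N: "\<And>n. n \<ge> N \<Longrightarrow> horo c d (geodesic_of v (\<sigma> * real n)) < 1 / Suc m"
        by (auto simp: eventually_sequentially)
      have "flowY p (\<sigma> * real n) (proj p v) \<in> thin p (1 / Suc m)" if "n \<ge> N" for n
        unfolding flowY_proj[OF v(1)] geodesic_flow_def
          proj_in_thin_iff[OF tangent_in_bundle[OF geodesic_of(1)[OF v(1)]]]
        using N[OF that] cd(1) by (auto simp: tangent_def)
      then show "\<exists>N. \<forall>n\<ge>N. flowY p (\<sigma> * real n) (proj p v) \<in> thin p (1 / Suc m)" by blast
    qed
  qed
  ultimately show ?thesis
    by (rule null_sets_completion_subset[rotated, OF null_sets_completionI])
qed

section \<open>Discreteness\<close>

text \<open>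
  The discriminant is an invariant of the form, so it is the same for all translates of the
  vertical lines.
\<close>
lemma moebius_vertical_iff_form:
  fixes p k :: nat
  assumes "det A = 1" "p > 0"
  obtains P Q R :: int where "Q\<^sup>2 - 4 * P * R = (int p)\<^sup>2"
    "\<And>z. Im z > 0 \<Longrightarrow> Re (moebius A z) = k / p \<longleftrightarrow> P * (cmod z)\<^sup>2 + Q * Re z + R = 0"
proof -
  define a where "a = A $ 1 $ 1"
  define b where "b = A $ 1 $ 2"
  define c where "c = A $ 2 $ 1"
  define d where "d = A $ 2 $ 2"
  have D: "a * d - b * c = 1" using assms(1) by (simp add: det_2 a_def b_def c_def d_def)
  define P where "P = int p * a * c - int k * c\<^sup>2"
  define Q where "Q = int p * (a * d + b * c) - 2 * int k * c * d"
  define R where "R = int p * b * d - int k * d\<^sup>2"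
  have "Q\<^sup>2 - 4 * P * R = (int p)\<^sup>2 * (a * d - b * c)\<^sup>2"
    unfolding P_def Q_def R_def by (simp add: power2_eq_square algebra_simps)
  then have 1: "Q\<^sup>2 - 4 * P * R = (int p)\<^sup>2" by (simp add: D)
  have 2: "Re (moebius A z) = k / p \<longleftrightarrow> P * (cmod z)\<^sup>2 + Q * Re z + R = 0" if z: "Im z > 0" for z
  proof -
    define U where "U = of_int a * z + of_int b"
    define V where "V = of_int c * z + of_int d"
    have V: "V \<noteq> 0" using automorphy_nonzero[OF assms(1) z] by (simp add: V_def automorphy_def c_def d_def)
    then have n: "(cmod V)\<^sup>2 > 0" by simp
    have "moebius A z = U / V" by (simp add: moebius_def U_def V_def a_def b_def c_def d_def)
    then have "Re (moebius A z) = Re (U * cnj V) / (cmod V)\<^sup>2"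
      by (simp add: Re_divide cmod_power2)
    moreover have "S / m = k / p \<longleftrightarrow> p * S - k * m = 0" if "m > 0" for S m :: real
      using assms(2) that by (simp add: field_simps)
    ultimately have "Re (moebius A z) = k / p \<longleftrightarrow> p * Re (U * cnj V) - k * (cmod V)\<^sup>2 = 0"
      using n by metis
    also have "p * Re (U * cnj V) - k * (cmod V)\<^sup>2 = P * (cmod z)\<^sup>2 + Q * Re z + R"
      unfolding cmod_power2 U_def V_def P_def Q_def R_def
      by (simp add: power2_eq_square algebra_simps)
    finally show ?thesis .
  qed
  show ?thesis using that[OF 1 2] .
qed

text \<open>
  At a zero \<open>z = x + \<i>y\<close> of the form, the discriminant equals \<open>(2Py)\<^sup>2 + (2Px + Q)\<^sup>2\<close>. A lower bound for \<open>y\<close>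
  therefore bounds \<open>P\<close>, then an upper bound for \<open>|x|\<close> bounds \<open>Q\<close>, and the equation bounds \<open>R\<close>.
\<close>
lemma finite_forms_meeting_bounded:
  fixes N :: int and M \<delta> :: real
  assumes "\<delta> > 0"
  shows "finite {(P :: int, Q :: int, R :: int). Q\<^sup>2 - 4 * P * R = N\<^sup>2 \<and>
    (\<exists>z. Im z \<ge> \<delta> \<and> cmod z \<le> M \<and> P * (cmod z)\<^sup>2 + Q * Re z + R = 0)}"
proof -
  define B1 where "B1 = \<bar>real_of_int N\<bar> / (2 * \<delta>)"
  define B2 where "B2 = \<bar>real_of_int N\<bar> + 2 * B1 * M"
  define B3 where "B3 = B1 * M\<^sup>2 + B2 * M"
  define K where "K = \<lceil>max B1 (max B2 B3)\<rceil>"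
  have bound: "P \<in> {-K..K} \<and> Q \<in> {-K..K} \<and> R \<in> {-K..K}"
    if disc: "Q\<^sup>2 - 4 * P * R = N\<^sup>2" and z: "Im z \<ge> \<delta>" "cmod z \<le> M"
      and zero: "P * (cmod z)\<^sup>2 + Q * Re z + R = 0" for P Q R :: int and z
  proof -
    define P' Q' R' where "P' = real_of_int P" and "Q' = real_of_int Q" and "R' = real_of_int R"
    have disc': "Q'\<^sup>2 - 4 * P' * R' = (real_of_int N)\<^sup>2"
      using arg_cong[OF disc, of real_of_int] by (simp add: P'_def Q'_def R'_def)
    have R: "R' = - (P' * ((Re z)\<^sup>2 + (Im z)\<^sup>2) + Q' * Re z)"
      using zero by (simp add: P'_def Q'_def R'_def cmod_power2)
    have key: "(2 * P' * Im z)\<^sup>2 + (2 * P' * Re z + Q')\<^sup>2 = (real_of_int N)\<^sup>2"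
      unfolding disc'[symmetric] R by (simp add: power2_eq_square algebra_simps)
    have "(2 * P' * Im z)\<^sup>2 \<le> (real_of_int N)\<^sup>2" "(2 * P' * Re z + Q')\<^sup>2 \<le> (real_of_int N)\<^sup>2"
      unfolding key[symmetric] by simp_all
    then have 1: "\<bar>2 * P' * Im z\<bar> \<le> \<bar>real_of_int N\<bar>" and 2: "\<bar>2 * P' * Re z + Q'\<bar> \<le> \<bar>real_of_int N\<bar>"
      by (simp_all only: abs_le_square_iff)
    have M: "0 \<le> M" "\<bar>Re z\<bar> \<le> M" using z(2) abs_Re_le_cmod[of z] norm_ge_zero[of z] by linarith+
    have "\<bar>P'\<bar> * (2 * \<delta>) \<le> \<bar>P'\<bar> * (2 * Im z)" using z(1) by (intro mult_left_mono) auto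
    also have "\<dots> \<le> \<bar>real_of_int N\<bar>" using 1 z(1) assms by (simp add: abs_mult)
    finally have P: "\<bar>P'\<bar> \<le> B1" using assms by (simp add: B1_def field_simps)
    have "\<bar>Q'\<bar> \<le> \<bar>real_of_int N\<bar> + 2 * (\<bar>P'\<bar> * \<bar>Re z\<bar>)" using 2 by (simp flip: abs_mult)
    also have "\<bar>P'\<bar> * \<bar>Re z\<bar> \<le> B1 * M" using P M by (intro mult_mono) auto
    finally have Q: "\<bar>Q'\<bar> \<le> B2" by (simp add: B2_def)
    have "\<bar>R'\<bar> \<le> \<bar>P'\<bar> * (cmod z)\<^sup>2 + \<bar>Q'\<bar> * \<bar>Re z\<bar>"
      unfolding R abs_minus_cancel cmod_power2[symmetric]
      by (rule order_trans[OF abs_triangle_ineq]) (simp add: abs_mult)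
    also have "\<dots> \<le> B1 * M\<^sup>2 + B2 * M"
      using P Q M z(2) by (intro add_mono mult_mono power_mono) auto
    finally have "\<bar>R'\<bar> \<le> B3" by (simp add: B3_def)
    then have "\<bar>P'\<bar> \<le> K" "\<bar>Q'\<bar> \<le> K" "\<bar>R'\<bar> \<le> K"
      using P Q le_of_int_ceiling[of "max B1 (max B2 B3)"] unfolding K_def by linarith+
    then show ?thesis unfolding P'_def Q'_def R'_def by (simp add: abs_le_iff)
  qed
  show ?thesis
    by (rule finite_subset[of _ "{-K..K} \<times> {-K..K} \<times> {-K..K}"]) (use bound in blast, simp)
qed

text \<open>
  Multiplied by \<open>(exp t / y)\<^sup>2\<close>, the form becomes a quadratic polynomial in \<open>exp (2t)\<close>.
\<close>
lemma geodesic_form_zeros: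
  fixes P Q R :: real
  assumes "geodesic \<gamma>" "\<not> (\<forall>t. P * (cmod (\<gamma> t))\<^sup>2 + Q * Re (\<gamma> t) + R = 0)"
  shows "finite {t. P * (cmod (\<gamma> t))\<^sup>2 + Q * Re (\<gamma> t) + R = 0}"
proof -
  have pos: "Im (\<gamma> t) > 0" for t by (rule geodesicD(1)[OF assms(1)])
  obtain a b c d where I: "\<And>t. 1 / Im (\<gamma> t) = a * exp t + b * exp (- t)"
    and X: "\<And>t. Re (\<gamma> t) / Im (\<gamma> t) = c * exp t + d * exp (- t)"
    using geodesic_exponential_coordinates[OF assms(1)] by blast
  define q where "q = [: P * d\<^sup>2 + Q * d * b + R * b\<^sup>2,
    P * (2 * c * d + 1) + Q * (c * b + a * d) + 2 * R * a * b, P * c\<^sup>2 + Q * c * a + R * a\<^sup>2 :]"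
  have q: "poly q (exp (2 * t)) = (P * (cmod (\<gamma> t))\<^sup>2 + Q * Re (\<gamma> t) + R) * (exp t / Im (\<gamma> t))\<^sup>2" for t
  proof -
    define E where "E = exp (2 * t)"
    define f where "f = a * E + b"
    define g where "g = c * E + d"
    have e: "exp t * exp t = E" "exp t * exp (- t) = 1" by (simp_all add: E_def flip: exp_add)
    have "exp t * (1 / Im (\<gamma> t)) = f" "exp t * (Re (\<gamma> t) / Im (\<gamma> t)) = g"
      unfolding I X f_def g_def using e by (simp_all add: distrib_left mult.left_commute)
    then have fg: "exp t = f * Im (\<gamma> t)" "exp t * Re (\<gamma> t) = g * Im (\<gamma> t)"
      using pos[of t] by (simp_all add: field_simps)
    have f: "exp t / Im (\<gamma> t) = f" using fg(1) pos[of t] by simp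
    have g: "f * Re (\<gamma> t) = g" using fg pos[of t] by (simp add: field_simps)
    have i: "(f * Im (\<gamma> t))\<^sup>2 = E" unfolding fg(1)[symmetric] using e(1) by (simp add: power2_eq_square)
    have "(P * (cmod (\<gamma> t))\<^sup>2 + Q * Re (\<gamma> t) + R) * (exp t / Im (\<gamma> t))\<^sup>2 =
      P * ((f * Re (\<gamma> t))\<^sup>2 + (f * Im (\<gamma> t))\<^sup>2) + Q * (f * Re (\<gamma> t)) * f + R * f\<^sup>2"
      unfolding f cmod_power2 by (simp add: power2_eq_square algebra_simps)
    also have "\<dots> = P * (g\<^sup>2 + E) + Q * g * f + R * f\<^sup>2" unfolding g i ..
    also have "\<dots> = poly q E"
      unfolding q_def f_def g_def by (simp add: power2_eq_square algebra_simps)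
    finally show ?thesis by (simp add: E_def)
  qed
  have zero: "P * (cmod (\<gamma> t))\<^sup>2 + Q * Re (\<gamma> t) + R = 0 \<longleftrightarrow> poly q (exp (2 * t)) = 0" for t
    unfolding q using pos[of t] by simp
  have "q \<noteq> 0" using assms(2) unfolding zero by auto
  then have "finite {x. poly q x = 0}" by (rule poly_roots_finite)
  then have "finite ((\<lambda>t. exp (2 * t)) -` {x. poly q x = 0})"
    by (rule finite_vimageI) (auto intro!: injI)
  then show ?thesis unfolding zero by (simp add: vimage_def)
qed

text \<open>
  If the translate contained the geodesic, the image of the tangent vector over \<open>k/p\<close> would be
  vertical of the right length, hence one of the two removed vectors.
\<close>
lemma C_hat_transversal:
  assumes "p > 0" "geodesic \<gamma>" "proj p (tangent \<gamma> t) \<in> C_hat p"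
  obtains A and k :: nat where "A \<in> Gamma0 p" "Re (moebius A (\<gamma> t)) = k / p"
    "\<not> (\<forall>s. Re (moebius A (\<gamma> s)) = k / p)"
proof -
  obtain k :: nat and y w where u: "y > 0" "cmod w = y" "proj p (tangent \<gamma> t) = proj p (Complex (k / p) y, w)"
    and nv: "proj p (tangent \<gamma> t) \<noteq> proj p (Complex (k / p) y, y *\<^sub>R \<i>)"
     "proj p (tangent \<gamma> t) \<noteq> proj p (Complex (k / p) y, - (y *\<^sub>R \<i>))"
    using assms(3) unfolding C_hat_iff by blast
  have "(Complex (k / p) y, w) \<in> unit_tangent_bundle" using u by (simp add: unit_tangent_bundle_iff)
  from proj_eq_iff[OF this tangent_in_bundle[OF assms(2), of t], of p] u(3)
  obtain A where A: "A \<in> Gamma0 p" "(Complex (k / p) y, w) = moebius_tangent A (tangent \<gamma> t)" by auto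
  have g: "geodesic (moebius A \<circ> \<gamma>)" and tA: "tangent (moebius A \<circ> \<gamma>) t = (Complex (k / p) y, w)"
    using geodesic_moebius[OF Gamma0_det[OF A(1)] assms(2)] A(2) by auto
  have "\<not> (\<forall>s. Re (moebius A (\<gamma> s)) = k / p)"
  proof
    assume "\<forall>s. Re (moebius A (\<gamma> s)) = k / p"
    then have "(\<lambda>s. Re ((moebius A \<circ> \<gamma>) s)) = (\<lambda>s. k / p)" by auto
    moreover have "((\<lambda>s. Re ((moebius A \<circ> \<gamma>) s)) has_real_derivative Re w) (at t)"
      using geodesicD(2)[OF g, of t] tA by (simp add: has_vector_derivative_complex_iff)
    ultimately have "Re w = 0" using DERIV_unique[OF _ DERIV_const] by metis
    then have "\<bar>Im w\<bar> = y" using u(2) by (simp add: cmod_eq_Im)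
    then have "w = y *\<^sub>R \<i> \<or> w = - (y *\<^sub>R \<i>)" using \<open>Re w = 0\<close> by (auto simp: complex_eq_iff abs_if split: if_splits)
    then show False using u(3) nv by auto
  qed
  moreover have "Re (moebius A (\<gamma> t)) = k / p" using arg_cong[OF tA, of fst] by (simp add: tangent_def)
  ultimately show ?thesis using that A(1) by blast
qed

lemma finite_C_hat_times:
  assumes "p > 0" "geodesic \<gamma>"
  shows "finite {t \<in> {a..b}. proj p (tangent \<gamma> t) \<in> C_hat p}"
proof (cases "a \<le> b")
  case False
  then show ?thesis by simp
next
  case True
  then have ne: "{a..b} \<noteq> {}" by simp
  have cont: "isCont \<gamma> t" for t
    using geodesicD(2)[OF assms(2)] by (rule has_vector_derivative_continuous)
  have "continuous_on {a..b} (\<lambda>t. Im (\<gamma> t))"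
    by (intro continuous_intros continuous_at_imp_continuous_on) (simp add: cont)
  from continuous_attains_inf[OF compact_Icc ne this]
  obtain s where s: "\<forall>t\<in>{a..b}. Im (\<gamma> s) \<le> Im (\<gamma> t)" by blast
  have "continuous_on {a..b} (\<lambda>t. cmod (\<gamma> t))"
    by (intro continuous_intros continuous_at_imp_continuous_on) (simp add: cont)
  from continuous_attains_sup[OF compact_Icc ne this]
  obtain s' where s': "\<forall>t\<in>{a..b}. cmod (\<gamma> t) \<le> cmod (\<gamma> s')" by blast
  define F where "F = {(P :: int, Q :: int, R :: int). Q\<^sup>2 - 4 * P * R = (int p)\<^sup>2 \<and>
    (\<exists>z. Im z \<ge> Im (\<gamma> s) \<and> cmod z \<le> cmod (\<gamma> s') \<and> P * (cmod z)\<^sup>2 + Q * Re z + R = 0)}"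
  have finF: "finite F"
    unfolding F_def by (rule finite_forms_meeting_bounded) (rule geodesicD(1)[OF assms(2)])
  define Z where "Z = (\<lambda>(P :: int, Q :: int, R :: int). {t. P * (cmod (\<gamma> t))\<^sup>2 + Q * Re (\<gamma> t) + R = 0})"
  have "{t \<in> {a..b}. proj p (tangent \<gamma> t) \<in> C_hat p} \<subseteq> (\<Union>x\<in>{x \<in> F. Z x \<noteq> UNIV}. Z x)"
  proof clarify
    fix t assume t: "t \<in> {a..b}" "proj p (tangent \<gamma> t) \<in> C_hat p"
    obtain A and k :: nat where A: "A \<in> Gamma0 p" "Re (moebius A (\<gamma> t)) = k / p"
      "\<not> (\<forall>s. Re (moebius A (\<gamma> s)) = k / p)"
      using C_hat_transversal[OF assms t(2)] .
    obtain P Q R :: int where PQR: "Q\<^sup>2 - 4 * P * R = (int p)\<^sup>2"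
      "\<And>z. Im z > 0 \<Longrightarrow> Re (moebius A z) = k / p \<longleftrightarrow> P * (cmod z)\<^sup>2 + Q * Re z + R = 0"
      by (rule moebius_vertical_iff_form[OF Gamma0_det[OF A(1)] assms(1), where k = k]) (rule that)
    have iff: "Re (moebius A (\<gamma> t)) = k / p \<longleftrightarrow> t \<in> Z (P, Q, R)" for t
      using PQR(2)[OF geodesicD(1)[OF assms(2)]] by (simp add: Z_def)
    have "(P, Q, R) \<in> F"
      using PQR(1) A(2) bspec[OF s t(1)] bspec[OF s' t(1)] unfolding iff by (auto simp: F_def Z_def)
    moreover have "Z (P, Q, R) \<noteq> UNIV" using A(3) unfolding iff by auto
    ultimately show "t \<in> (\<Union>x\<in>{x \<in> F. Z x \<noteq> UNIV}. Z x)" using A(2) unfolding iff by blast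
  qed
  moreover have "finite (\<Union>x\<in>{x \<in> F. Z x \<noteq> UNIV}. Z x)"
  proof (rule finite_UN_I)
    show "finite {x \<in> F. Z x \<noteq> UNIV}" using finF by simp
    fix x assume "x \<in> {x \<in> F. Z x \<noteq> UNIV}"
    then have "Z x \<noteq> UNIV" by simp
    then show "finite (Z x)"
    proof (cases x)
      case (fields P Q R)
      assume "Z x \<noteq> UNIV"
      then have "\<not> (\<forall>t. P * (cmod (\<gamma> t))\<^sup>2 + Q * Re (\<gamma> t) + R = 0)" by (auto simp: fields Z_def)
      from geodesic_form_zeros[OF assms(2) this] show ?thesis by (simp add: fields Z_def)
    qed
  qed
  ultimately show ?thesis by (rule finite_subset)
qed

lemma C_hat_discrete:
  assumes "p > 0" "G \<in> geodesicsY p" "tangentY p G t \<in> C_hat p"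
  shows "\<exists>\<epsilon>>0. tangentY p G ` {t - \<epsilon> <..< t + \<epsilon>} \<inter> C_hat p = {tangentY p G t}"
proof -
  obtain \<gamma> where g: "geodesic \<gamma>" "G = geodesic_class p \<gamma>" using assms(2) by (auto simp: geodesicsY_def)
  have G: "tangentY p G s = proj p (tangent \<gamma> s)" for s using tangentY_class[OF g(1)] g(2) by simp
  obtain r where r: "r > 0"
    "\<forall>s\<in>{s \<in> {t - 1..t + 1}. proj p (tangent \<gamma> s) \<in> C_hat p}. s \<noteq> t \<longrightarrow> r \<le> dist t s"
    using finite_set_avoid[OF finite_C_hat_times[OF assms(1) g(1)], where a = t] by blast
  have "s = t" if "s \<in> {t - min r 1 <..< t + min r 1}" "tangentY p G s \<in> C_hat p" for s
  proof (rule ccontr)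
    assume "s \<noteq> t"
    moreover have "s \<in> {s \<in> {t - 1..t + 1}. proj p (tangent \<gamma> s) \<in> C_hat p}"
      using that unfolding G by auto
    ultimately have "r \<le> dist t s" using r(2) by blast
    then show False using that(1) by (auto simp: dist_real_def)
  qed
  then have "tangentY p G ` {t - min r 1 <..< t + min r 1} \<inter> C_hat p \<subseteq> {tangentY p G t}"
    by blast
  moreover have "t \<in> {t - min r 1 <..< t + min r 1}" using r(1) by simp
  ultimately have "tangentY p G ` {t - min r 1 <..< t + min r 1} \<inter> C_hat p = {tangentY p G t}"
    using assms(3) by blast
  then show ?thesis using r(1) by (intro exI[of _ "min r 1"]) simp
qed

lemma C_hat_subset_SY: "C_hat p \<subseteq> SY p"
proof
  fix u assume "u \<in> C_hat p"
  then obtain k :: nat and y w where "y > 0" "cmod w = y" "u = proj p (Complex (k / p) y, w)"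
    unfolding C_hat_iff by blast
  then show "u \<in> SY p" by (auto simp: SY_def unit_tangent_bundle_iff)
qed

text \<open>Almost everywhere statements are transferred to \<open>\<nu>\<close> only for properties that ignore the time origin.\<close>
lemma infinitely_often_time_shift:
  assumes "G \<in> geodesicsY p"
  shows "infinitely_often_future p C (time_shift s G) \<longleftrightarrow> infinitely_often_future p C G"
    and "infinitely_often_past p C (time_shift s G) \<longleftrightarrow> infinitely_often_past p C G"
proof -
  have shift: "time_shift s G \<in> geodesicsY p \<and> tangentY p (time_shift s G) t = tangentY p G (t + s)"
    if G: "G \<in> geodesicsY p" for G s t
  proof -
    obtain \<gamma> where g: "geodesic \<gamma>" "G = geodesic_class p \<gamma>" using G by (auto simp: geodesicsY_def)
    show ?thesis
      using geodesic_shift[OF g(1)] tangentY_class[OF g(1)] tangentY_class[OF geodesic_shift(1)[OF g(1)]]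
      by (auto simp: g(2) time_shift_class geodesicsY_def)
  qed
  have undo: "time_shift (- s) (time_shift s G) = G"
    by (simp add: time_shift_def image_image)
  have fut: "infinitely_often_future p C (time_shift s G)"
    if G: "infinitely_often_future p C G" "G \<in> geodesicsY p" for G s
  proof -
    obtain t :: "nat \<Rightarrow> real" where t: "filterlim t at_top sequentially" "\<And>n. tangentY p G (t n) \<in> C"
      using G(1) by (auto simp: infinitely_often_future_def)
    have "filterlim (\<lambda>n. t n - s) at_top sequentially"
      using filterlim_tendsto_add_at_top[OF tendsto_const[of "- s"] t(1)] by simp
    then show ?thesis using t(2) shift[OF G(2)]
      by (auto simp: infinitely_often_future_def intro!: exI[of _ "\<lambda>n. t n - s"])
  qed
  have past: "infinitely_often_past p C (time_shift s G)"
    if G: "infinitely_often_past p C G" "G \<in> geodesicsY p" for G s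
  proof -
    obtain t :: "nat \<Rightarrow> real" where t: "filterlim t at_bot sequentially" "\<And>n. tangentY p G (t n) \<in> C"
      using G(1) by (auto simp: infinitely_often_past_def)
    have "filterlim (\<lambda>n. t n - s) at_bot sequentially"
      using filterlim_tendsto_add_at_top[OF tendsto_const[of s] t(1)[unfolded filterlim_uminus_at_bot]]
      by (simp add: filterlim_uminus_at_bot)
    then show ?thesis using t(2) shift[OF G(2)]
      by (auto simp: infinitely_often_past_def intro!: exI[of _ "\<lambda>n. t n - s"])
  qed
  show "infinitely_often_future p C (time_shift s G) \<longleftrightarrow> infinitely_often_future p C G"
    using fut[OF _ assms, of s] fut[of "time_shift s G" "- s"] shift[OF assms, of s] undo by auto
  show "infinitely_often_past p C (time_shift s G) \<longleftrightarrow> infinitely_often_past p C G"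
    using past[OF _ assms, of s] past[of "time_shift s G" "- s"] shift[OF assms, of s] undo by auto
qed

lemma nonrecurrent_tangents_null:
  assumes "prime p" "invariant_borel_prob p \<nu>"
  shows "{tangentY p G t | G t. G \<in> geodesicsY p \<and>
      \<not> (infinitely_often_past p (C_hat p) G \<and> infinitely_often_future p (C_hat p) G)}
    \<in> null_sets (completion \<nu>)"
proof (rule null_sets_completion_subset)
  let ?N = "\<lambda>\<sigma>::real. {proj p v | v. v \<in> unit_tangent_bundle \<and> cuspidal (\<lambda>t. geodesic_of v (\<sigma> * t))}"
  show "?N 1 \<union> ?N (- 1) \<in> null_sets (completion \<nu>)"
    using cuspidal_null[OF assms(2), of 1] cuspidal_null[OF assms(2), of "- 1"] by (rule null_sets.Un)
  show "{tangentY p G t | G t. G \<in> geodesicsY p \<and>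
      \<not> (infinitely_often_past p (C_hat p) G \<and> infinitely_often_future p (C_hat p) G)} \<subseteq> ?N 1 \<union> ?N (- 1)"
  proof
    fix u
    assume "u \<in> {tangentY p G t | G t. G \<in> geodesicsY p \<and>
      \<not> (infinitely_often_past p (C_hat p) G \<and> infinitely_often_future p (C_hat p) G)}"
    then obtain G t where G: "G \<in> geodesicsY p" and u: "u = tangentY p G t"
      and n: "\<not> (infinitely_often_past p (C_hat p) G \<and> infinitely_often_future p (C_hat p) G)"
      by blast
    obtain \<gamma> where g: "geodesic \<gamma>" "G = geodesic_class p \<gamma>" using G by (auto simp: geodesicsY_def)
    have uv: "u = proj p (tangent \<gamma> t)" using tangentY_class[OF g(1)] g(2) u by simp
    have v: "tangent \<gamma> t \<in> unit_tangent_bundle" by (rule tangent_in_bundle[OF g(1)])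
    have flow: "geodesic_of (tangent \<gamma> t) = (\<lambda>s. \<gamma> (s + t))"
      using geodesic_shift[OF g(1), of t] by (intro geodesic_of_eq) auto
    have "cuspidal \<gamma> \<or> cuspidal (\<lambda>s. \<gamma> (- s))"
      using n noncuspidal_infinitely_often_future[OF assms(1) g(1)]
        noncuspidal_infinitely_often_past[OF assms(1) g(1)] g(2) by blast
    then show "u \<in> ?N 1 \<union> ?N (- 1)"
    proof
      assume "cuspidal \<gamma>"
      from cuspidal_shift[OF this, of t] have "cuspidal (\<lambda>s. geodesic_of (tangent \<gamma> t) (1 * s))"
        unfolding flow by simp
      then show ?thesis using v unfolding uv by blast
    next
      assume "cuspidal (\<lambda>s. \<gamma> (- s))"
      from cuspidal_shift[OF this, of "- t"] have "cuspidal (\<lambda>s. geodesic_of (tangent \<gamma> t) (- 1 * s))"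
        unfolding flow by simp
      then show ?thesis using v unfolding uv by blast
    qed
  qed
qed

theorem theorem3p5:
  fixes p :: nat
    and \<nu> :: "(complex \<times> complex) set measure"
    and \<mu> :: "(real \<Rightarrow> complex) set measure"
  assumes "prime p"
    and "invariant_borel_prob p \<nu>"
    and "induced_by p \<nu> \<mu>"
  shows "cross_section p \<mu> (C_hat p)"
  unfolding cross_section_def
proof (intro conjI ballI allI impI)
  show "C_hat p \<subseteq> SY p" by (rule C_hat_subset_SY)
  let ?P = "\<lambda>G. infinitely_often_past p (C_hat p) G \<and> infinitely_often_future p (C_hat p) G"
  have "\<forall>G\<in>geodesicsY p. \<forall>s. ?P (time_shift s G) \<longleftrightarrow> ?P G"
    using infinitely_often_time_shift by simp
  moreover have "(\<forall>G\<in>geodesicsY p. \<forall>s. ?P (time_shift s G) \<longleftrightarrow> ?P G) \<longrightarrow>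
      ((AE G in \<mu>. ?P G) \<longleftrightarrow>
       {tangentY p G t | G t. G \<in> geodesicsY p \<and> \<not> ?P G} \<in> null_sets (completion \<nu>))"
    by (rule assms(3)[unfolded induced_by_def, THEN conjunct2, THEN spec, of ?P])
  ultimately show "AE G in \<mu>. ?P G"
    using nonrecurrent_tangents_null[OF assms(1,2)] by simp
  show "\<exists>\<epsilon>>0. tangentY p G ` {t - \<epsilon> <..< t + \<epsilon>} \<inter> C_hat p = {tangentY p G t}"
    if "G \<in> geodesicsY p" "tangentY p G t \<in> C_hat p" for G t
    using C_hat_discrete[OF prime_gt_0_nat[OF assms(1)] that] .
qed

end
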